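(* There is an infinite sequence of $3$-regular graphs $G$ (with $n$ vertices, $n\to\infty$) and a constant $\delta>0$ such that, with probability $1-o(1)$ over the choice of a uniformly random ordering $\pi$ of $V(G)$, the graph $T_3(G,\pi)$ has a connected component of at least $\delta n$ vertices. Moreover, with probability $1-o(1)$ over the choice of $\pi$, $T_3(G,\pi)$ has treewidth $\Omega(n)$.
   Context: For a finite graph $G=(V,E)$, a permutation $\pi$ of $V$ and an integer $k\ge 1$, $L_k(G,\pi)$ is the set of vertices with exactly $k-1$ neighbors preceding them in $\pi$, and $T_k(G,\pi)=\bigcup_{i=1}^k L_i(G,\pi)$, regarded as the subgraph of $G$ induced on this vertex set. *)

theory Defs
  imports
    "HOL-Probability.Probability"
    "HOL-Combinatorics.Multiset_Permutations"
    "Graph_Theory.Digraph_Component"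
begin

text \<open>
  Finite simple graphs are the symmetric digraphs of the locale \<^locale>\<open>graph\<close>: finite, loop-free,
  without parallel arcs, each undirected edge being a pair of opposite arcs.  Hence the degree of a
  vertex is its \<^const>\<open>out_degree\<close>, and the strongly connected components
  \<^const>\<open>pre_digraph.sccs\<close> are the connected components.
\<close>

definition regular_graph :: "nat \<Rightarrow> ('a, 'b) pre_digraph \<Rightarrow> bool" where
  "regular_graph d G \<longleftrightarrow> graph G \<and> (\<forall>v \<in> verts G. out_degree G v = d)"

text \<open>
  An ordering of \<open>V\<close> is an element of \<^term>\<open>permutations_of_set V\<close>, that is, a list enumerating
  \<open>V\<close> without repetition.
\<close>

definition precedes :: "'a list \<Rightarrow> 'a \<Rightarrow> 'a \<Rightarrow> bool" where
  "precedes \<pi> u v \<longleftrightarrow> (\<exists>i j. i < j \<and> j < length \<pi> \<and> \<pi> ! i = u \<and> \<pi> ! j = v)"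

text \<open>\<open>L\<^sub>k(G,\<pi>)\<close>, meaningful only for \<open>k \<ge> 1\<close> because of the truncated subtraction.\<close>

definition layer :: "nat \<Rightarrow> ('a, 'b) pre_digraph \<Rightarrow> 'a list \<Rightarrow> 'a set" where
  "layer k G \<pi> = {v \<in> verts G. card {u \<in> verts G. u \<rightarrow>\<^bsub>G\<^esub> v \<and> precedes \<pi> u v} = k - 1}"

text \<open>\<open>T\<^sub>k(G,\<pi>)\<close>, as an induced subgraph.\<close>

definition layer_graph :: "nat \<Rightarrow> ('a, 'b) pre_digraph \<Rightarrow> 'a list \<Rightarrow> ('a, 'b) pre_digraph" where
  "layer_graph k G \<pi> = G \<restriction> (\<Union>i\<in>{1..k}. layer i G \<pi>)"

text \<open>
  The constant \<^const>\<open>Digraph_Component.tree\<close> only excludes directed cycles and so rejects every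
  symmetric digraph with an edge (\<open>u, v, u\<close> counts as a cycle).  The cycles of a simple graph are
  the directed cycles of length at least 3 of its symmetric digraph.
\<close>

definition undirected_tree :: "('a, 'b) pre_digraph \<Rightarrow> bool" where
  "undirected_tree T \<longleftrightarrow>
     graph T \<and> Digraph_Component.connected T \<and> \<not> (\<exists>p. pre_digraph.cycle T p \<and> length p \<ge> 3)"

definition tree_decomposition ::
    "('a, 'b) pre_digraph \<Rightarrow> ('t, 's) pre_digraph \<Rightarrow> ('t \<Rightarrow> 'a set) \<Rightarrow> bool" where
  "tree_decomposition G T B \<longleftrightarrow>
     undirected_tree T \<and>
     (\<Union>t\<in>verts T. B t) = verts G \<and>
     (\<forall>u v. u \<rightarrow>\<^bsub>G\<^esub> v \<longrightarrow> (\<exists>t\<in>verts T. u \<in> B t \<and> v \<in> B t)) \<and>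
     (\<forall>v\<in>verts G. Digraph_Component.connected (T \<restriction> {t \<in> verts T. v \<in> B t}))"

text \<open>
  The subtraction is truncated, which matters only for the null graph: its treewidth is \<open>0\<close> here,
  not \<open>-1\<close>.
\<close>

definition decomposition_width :: "('t, 's) pre_digraph \<Rightarrow> ('t \<Rightarrow> 'a set) \<Rightarrow> nat" where
  "decomposition_width T B = Max ((\<lambda>t. card (B t)) ` verts T) - 1"

text \<open>
  Decomposition trees are finite, so it is no restriction to take their nodes from \<^typ>\<open>nat\<close>.
\<close>

definition treewidth :: "('a, 'b) pre_digraph \<Rightarrow> nat" where
  "treewidth G =
     (LEAST w. \<exists>(T :: nat pair_pre_digraph) B.
        tree_decomposition G (with_proj T) B \<and> decomposition_width (with_proj T) B = w)"

definition random_ordering :: "('a, 'b) pre_digraph \<Rightarrow> 'a list pmf" where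
  "random_ordering G = pmf_of_set (permutations_of_set (verts G))"

end

theory Submission
  imports Defs "HOL-Library.Sublist" "HOL-Real_Asymp.Real_Asymp"
begin

text \<open>
  Let \<open>G\<close> be cubic with \<open>n\<close> vertices.  The complement of \<open>T\<^sub>3\<close> is the set \<open>D\<close> of vertices preceded by
  all their neighbours.  It is independent, so \<open>T\<^sub>3\<close> has \<open>3n/2 - 3 |D|\<close> edges and \<open>n - |D|\<close> vertices,
  and since \<open>|D|\<close> has mean \<open>n/4\<close> these numbers agree on average.  In a triangle-free \<open>G\<close> a positive
  fraction (at least \<open>1/120\<close>) of the vertices is expected to be isolated in \<open>T\<^sub>3\<close>; let the core be
  \<open>T\<^sub>3\<close> without them.  By Chebyshev's inequality, the core has with high probability at least
  \<open>n/240\<close> more edges than vertices.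

  On the other hand, by a first moment bound there is a lift of \<open>K\<^sub>3\<^sub>,\<^sub>3\<close> in which no set of at most
  \<open>\<kappa> n\<close> vertices spans more than \<open>1 + 1/480\<close> edges per vertex.  Thus the core cannot fall into
  components of at most \<open>\<kappa> n\<close> vertices.  Nor can it do so after the removal of a small multiple of
  \<open>n\<close> vertices, whereas a tree decomposition of width less than \<open>c n\<close> would yield such a set,
  consisting of boundedly many bags.
\<close>

section \<open>Sparse sets and tree decompositions\<close>

text \<open>The tie between edges and vertices is the obstacle: with no linear surplus, all
  components could be small unicyclic graphs. Discarding isolated vertices breaks the tie because it
  costs vertices but no edges. The bound 1/120 is 1 / (10 choose 3): it is the chance that the three
  neighbours of \<open>v\<close> come last in the ball of radius 2 around \<open>v\<close>, which
  has at most 10 vertices. Triangle-freeness makes this enough for \<open>v\<close> to be isolated.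
  The randomness of the graph and that of \<pi> never meet: sparseness of all small sets at once is
  a property of the fixed graph, so \<pi> has to be controlled only through one sum of local terms,
  and both claims follow from the same event. The density 1/480 is half of the surplus 1/240; the
  other half pays for the arcs lost with the bags. Every lift is simple and triangle-free, so the
  count of bad lifts needs no conditioning, unlike a pairing model.\<close>

definition inner_arcs :: "('a \<times> 'a) set \<Rightarrow> 'a set \<Rightarrow> nat" where
  "inner_arcs P S = card (P \<inter> S \<times> S)"

text \<open>
  At most \<open>1 + 1/L\<close> edges per vertex; the factor \<open>2\<close> is there because an edge is a pair of arcs.
\<close>

definition sparse_arcs :: "('a \<times> 'a) set \<Rightarrow> nat \<Rightarrow> 'a set \<Rightarrow> bool" where
  "sparse_arcs P L S \<longleftrightarrow> L * inner_arcs P S \<le> 2 * (L + 1) * card S"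

text \<open>Both sides of the inequality are additive over a partition that no arc crosses. The
  fibres of \<open>f\<close> will be pieces left by deleting a bag in one use and parts of
  components in the other.\<close>

lemma sparse_arcs_fibres:
  fixes f :: "'a \<Rightarrow> 'c"
  assumes fin: "finite S"
    and f: "\<And>u v. (u, v) \<in> P \<Longrightarrow> u \<in> S \<Longrightarrow> v \<in> S \<Longrightarrow> f u = f v"
    and sp: "\<And>c. c \<in> f ` S \<Longrightarrow> sparse_arcs P L {v \<in> S. f v = c}"
  shows "sparse_arcs P L S"
proof -
  let ?F = "\<lambda>c. {v \<in> S. f v = c}"
  have 1: "P \<inter> S \<times> S = (\<Union>c\<in>f ` S. P \<inter> ?F c \<times> ?F c)"
    using f by auto
  have "inner_arcs P S = (\<Sum>c\<in>f ` S. inner_arcs P (?F c))"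
    unfolding inner_arcs_def
    by (subst 1, rule card_UN_disjoint) (use fin in auto)
  moreover have "card S = (\<Sum>c\<in>f ` S. card (?F c))"
  proof -
    have "S = (\<Union>c\<in>f ` S. ?F c)" by auto
    then have "card S = card (\<Union>c\<in>f ` S. ?F c)" by simp
    also have "\<dots> = (\<Sum>c\<in>f ` S. card (?F c))"
      by (rule card_UN_disjoint) (use fin in auto)
    finally show ?thesis .
  qed
  ultimately show ?thesis
    using sp unfolding sparse_arcs_def
    by (simp add: sum_distrib_left sum_mono)
qed

text \<open>Every arc inside \<open>U\<close> touches the separator \<open>X\<close> or stays inside
  \<open>A\<close> or \<open>W\<close>. At most \<open>d * card X\<close> arcs leave
  \<open>X\<close> and as many enter it, hence the factor \<open>2 * d\<close>.\<close>

lemma inner_arcs_remove: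
  assumes fin: "finite U" and sym: "sym P" 
    and deg: "\<And>v. v \<in> U \<Longrightarrow> card {u. (v, u) \<in> P} \<le> d" "\<And>v. v \<in> U \<Longrightarrow> finite {u. (v, u) \<in> P}"
    and X: "X \<subseteq> U" and U: "U \<subseteq> X \<union> A \<union> W" and finAW: "finite A" "finite W"
    and sep: "\<And>u v. (u, v) \<in> P \<Longrightarrow> u \<in> A \<Longrightarrow> v \<in> W \<Longrightarrow> v \<in> X \<or> u \<in> X"
  shows "inner_arcs P U \<le> 2 * d * card X + inner_arcs P A + inner_arcs P W"
proof -
  let ?O = "SIGMA v:X. {u. (v, u) \<in> P}"
  have finX: "finite X" using X fin finite_subset by blast
  have finO: "finite ?O" using finX deg X by auto
  have "card ?O = (\<Sum>v\<in>X. card {u. (v, u) \<in> P})"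
    by (rule card_SigmaI) (use finX deg X in auto)
  also have "\<dots> \<le> d * card X"
    using sum_bounded_above[of X "\<lambda>v. card {u. (v, u) \<in> P}" d] deg X by (auto simp: mult.commute)
  finally have O: "card ?O \<le> d * card X" .
  have O': "card (prod.swap ` ?O) \<le> d * card X"
    using card_image_le[OF finO, of prod.swap] O by linarith
  have sub: "P \<inter> U \<times> U \<subseteq> ?O \<union> prod.swap ` ?O \<union> (P \<inter> A \<times> A) \<union> (P \<inter> W \<times> W)"
  proof
    fix e assume e: "e \<in> P \<inter> U \<times> U"
    obtain u v where uv: "e = (u, v)" by fastforce
    have "(v, u) \<in> P" using e uv sym by (auto elim: symE)
    then have "e \<in> prod.swap ` ?O" if "v \<in> X" using that uv by force
    moreover have "e \<in> ?O" if "u \<in> X" using that uv e by simp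
    moreover have "e \<in> (P \<inter> A \<times> A) \<union> (P \<inter> W \<times> W)" if "u \<notin> X" "v \<notin> X"
      using that uv e U sep[of u v] sep[of v u] \<open>(v, u) \<in> P\<close> by auto
    ultimately show "e \<in> ?O \<union> prod.swap ` ?O \<union> (P \<inter> A \<times> A) \<union> (P \<inter> W \<times> W)" by blast
  qed
  have "inner_arcs P U \<le> card (?O \<union> prod.swap ` ?O \<union> (P \<inter> A \<times> A) \<union> (P \<inter> W \<times> W))"
    unfolding inner_arcs_def by (rule card_mono[OF _ sub]) (use finO finAW in auto)
  also have "\<dots> \<le> card ?O + card (prod.swap ` ?O) + inner_arcs P A + inner_arcs P W"
    unfolding inner_arcs_def by (meson add_le_mono card_Un_le le_refl le_trans)
  finally show ?thesis using O O' by simp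
qed

section \<open>Rooted trees and their branches\<close>

definition avoiding :: "('t \<times> 't) set \<Rightarrow> 't \<Rightarrow> ('t \<times> 't) set" where
  "avoiding E t = {(a, b) \<in> E. a \<noteq> t \<and> b \<noteq> t}"

text \<open>In a tree this is the set of descendants of \<open>t\<close>; no parent relation is needed.\<close>

definition tree_branch :: "'t set \<Rightarrow> ('t \<times> 't) set \<Rightarrow> 't \<Rightarrow> 't \<Rightarrow> 't set" where
  "tree_branch N E r t = {s \<in> N. s = t \<or> (r, s) \<notin> (avoiding E t)\<^sup>*}"

lemma sym_rtrancl_avoiding: "sym E \<Longrightarrow> sym ((avoiding E t)\<^sup>*)"
  by (rule sym_rtrancl) (auto simp: avoiding_def sym_def)

lemma rtrancl_avoiding_neq: "(a, b) \<in> (avoiding E t)\<^sup>* \<Longrightarrow> a \<noteq> t \<Longrightarrow> b \<noteq> t"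
  by (induction rule: rtrancl_induct) (auto simp: avoiding_def)

text \<open>\<open>c\<close> is the node from which a walk from \<open>a\<close> first steps into
  \<open>t\<close>.\<close>

lemma first_hit_avoiding:
  assumes "(a, t) \<in> E\<^sup>*" "a \<noteq> t"
  obtains c where "(a, c) \<in> (avoiding E t)\<^sup>*" "(c, t) \<in> E" "c \<noteq> t"
proof -
  have "(a, b) \<in> (avoiding E t)\<^sup>* \<or> (\<exists>c. (a, c) \<in> (avoiding E t)\<^sup>* \<and> (c, t) \<in> E \<and> c \<noteq> t)"
    if "(a, b) \<in> E\<^sup>*" for b
    using that
  proof (induction rule: rtrancl_induct)
    case (step y z)
    show ?case
    proof (cases "(a, y) \<in> (avoiding E t)\<^sup>*")
      case True
      then have "y \<noteq> t" using rtrancl_avoiding_neq assms(2) by metis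
      with True step(2) show ?thesis
        by (cases "z = t") (auto simp: avoiding_def intro: rtrancl_into_rtrancl)
    qed (use step in auto)
  qed auto
  from this[OF assms(1)] show ?thesis
    using rtrancl_avoiding_neq assms(2) that by metis
qed

text \<open>Acyclicity appears only in the form that branches use: deleting \<open>t\<close> leaves
  its neighbours in different components. Thus neither paths nor cycles have to be handled
  below.\<close>

locale rooted_tree =
  fixes N :: "'t set" and E :: "('t \<times> 't) set" and r :: 't
  assumes finite_nodes: "finite N" and root: "r \<in> N" and sym_E: "sym E" and E_sub: "E \<subseteq> N \<times> N"
    and conn: "x \<in> N \<Longrightarrow> (r, x) \<in> E\<^sup>*"
    and acyclic_nbrs: "(t, c) \<in> E \<Longrightarrow> (t, c') \<in> E \<Longrightarrow> c \<noteq> t \<Longrightarrow> c' \<noteq> t \<Longrightarrow>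
      (c, c') \<in> (avoiding E t)\<^sup>* \<Longrightarrow> c = c'"
begin

abbreviation "branch \<equiv> tree_branch N E r"

lemma branch_root: "branch r = N"
proof -
  have "s = r" if "(r, s) \<in> (avoiding E r)\<^sup>*" for s
    using that by (induction rule: rtrancl_induct) (auto simp: avoiding_def)
  then show ?thesis by (auto simp: tree_branch_def)
qed

text \<open>Here \<open>c\<close> is a neighbour of \<open>t\<close> on the side away from the root.
  After deletion of \<open>t\<close>, the component of \<open>c\<close> can be entered only from
  \<open>t\<close>, and \<open>c\<close> is the only neighbour of \<open>t\<close> in it. So every
  walk from the root into this component meets \<open>c\<close>.\<close>

lemma child_branch:
  assumes t: "(t, c) \<in> E" "c \<noteq> t" and c: "(r, c) \<notin> (avoiding E t)\<^sup>*"
  shows "(avoiding E t)\<^sup>* `` {c} \<subseteq> branch c" and "branch c \<subset> branch t"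
proof -
  let ?C = "(avoiding E t)\<^sup>* `` {c}"
  have symE': "\<And>a b. (a, b) \<in> E \<Longrightarrow> (b, a) \<in> E" using sym_E by (auto elim: symE)
  have symt: "\<And>a b. (a, b) \<in> (avoiding E t)\<^sup>* \<Longrightarrow> (b, a) \<in> (avoiding E t)\<^sup>*"
    using sym_rtrancl_avoiding[OF sym_E] by (auto elim: symE)
  have CN: "?C \<subseteq> N"
  proof
    fix x assume "x \<in> ?C"
    then have "(c, x) \<in> (avoiding E t)\<^sup>*" by simp
    then show "x \<in> N" using t E_sub by (induction rule: rtrancl_induct) (auto simp: avoiding_def)
  qed
  have rC: "r \<notin> ?C" using c symt by auto
  have not_through: "y \<notin> ?C" if "(r, y) \<in> (avoiding E c)\<^sup>*" for y
    using that
  proof (induction rule: rtrancl_induct)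
    case (step y z)
    show ?case
    proof
      assume z: "z \<in> ?C"
      then have "z \<noteq> t" using rtrancl_avoiding_neq t(2) by fastforce
      show False
      proof (cases "y = t")
        case True
        then have "c = z" using acyclic_nbrs[of t c z] t step(2) z \<open>z \<noteq> t\<close> by (auto simp: avoiding_def)
        then show False using step(2) by (auto simp: avoiding_def)
      next
        case False
        then have "(z, y) \<in> avoiding E t" using step(2) \<open>z \<noteq> t\<close> symE' by (auto simp: avoiding_def)
        then have "y \<in> ?C" using z by (auto intro: rtrancl_into_rtrancl)
        then show False using step.IH by blast
      qed
    qed
  qed (use rC in auto)
  show "?C \<subseteq> branch c"
    using CN not_through by (auto simp: tree_branch_def)
  \<comment> \<open>Since \<open>t\<close> separates \<open>c\<close> from the root, a walk from the
    root that avoids \<open>t\<close> also avoids \<open>c\<close>. Hence nodes outside the branch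
    of \<open>t\<close> are outside the branch of \<open>c\<close>.\<close>
  have avoid_c: "(r, y) \<in> (avoiding E c)\<^sup>*" if "(r, y) \<in> (avoiding E t)\<^sup>*" for y
    using that
  proof (induction rule: rtrancl_induct)
    case (step y z)
    have "y \<noteq> c" using step(1) c by auto
    moreover have "z \<noteq> c" using step(1,2) c by (auto intro: rtrancl_into_rtrancl)
    ultimately have "(y, z) \<in> avoiding E c" using step(2) by (auto simp: avoiding_def)
    then show ?case using step.IH by (auto intro: rtrancl_into_rtrancl)
  qed auto
  have rc: "r \<noteq> c" using c by auto
  \<comment> \<open>The root reaches \<open>t\<close> without \<open>c\<close>, which makes the
    inclusion of the branches strict.\<close>
  have tc: "(r, t) \<in> (avoiding E c)\<^sup>*"
  proof (cases "r = t")
    case False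
    have "(r, t) \<in> E\<^sup>*" using conn t E_sub by auto
    then obtain y where y: "(r, y) \<in> (avoiding E t)\<^sup>*" "(y, t) \<in> E" "y \<noteq> t"
      using False first_hit_avoiding by metis
    then have "y \<noteq> c" using c by auto
    then have "(y, t) \<in> avoiding E c" using y t by (auto simp: avoiding_def)
    then show ?thesis using avoid_c[OF y(1)] by (auto intro: rtrancl_into_rtrancl)
  qed auto
  have "t \<notin> branch c" using tc t by (auto simp: tree_branch_def)
  moreover have "t \<in> branch t" using t E_sub by (auto simp: tree_branch_def)
  moreover have "branch c \<subseteq> branch t"
    using avoid_c c by (auto simp: tree_branch_def)
  ultimately show "branch c \<subset> branch t" by blast
qed

text \<open>Take for \<open>c\<close> the last node before the first visit to \<open>t\<close> on a
  walk from \<open>s\<close>. It is in the component of \<open>s\<close> and so, like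
  \<open>s\<close>, cut off from the root.\<close>

lemma branch_member_child:
  assumes "s \<in> branch t" "s \<noteq> t"
  obtains c where "(t, c) \<in> E" "c \<noteq> t" "(r, c) \<notin> (avoiding E t)\<^sup>*" "(c, s) \<in> (avoiding E t)\<^sup>*"
proof -
  have symE': "\<And>a b. (a, b) \<in> E \<Longrightarrow> (b, a) \<in> E" using sym_E by (auto elim: symE)
  have symt: "\<And>a b. (a, b) \<in> (avoiding E t)\<^sup>* \<Longrightarrow> (b, a) \<in> (avoiding E t)\<^sup>*"
    using sym_rtrancl_avoiding[OF sym_E] by (auto elim: symE)
  have s: "s \<in> N" "(r, s) \<notin> (avoiding E t)\<^sup>*" using assms by (auto simp: tree_branch_def)
  \<comment> \<open>If no walk led from \<open>s\<close> to \<open>t\<close>, the walk from the root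
    to \<open>s\<close> would avoid \<open>t\<close>, against
    \<open>s \<in> branch t\<close>.\<close>
  have "(s, t) \<in> E\<^sup>*"
  proof (rule ccontr)
    assume not: "(s, t) \<notin> E\<^sup>*"
    have "(r, s) \<in> E\<^sup>*" using conn s by auto
    have "(s, r) \<in> E\<^sup>*" using \<open>(r, s) \<in> E\<^sup>*\<close> sym_rtrancl[OF sym_E] by (auto elim: symE)
    have "(r, y) \<in> (avoiding E t)\<^sup>*" if "(r, y) \<in> E\<^sup>*" for y
      using that
    proof (induction rule: rtrancl_induct)
      case (step y z)
      then have "y \<noteq> t" "z \<noteq> t" using not \<open>(s, r) \<in> E\<^sup>*\<close>
        by (meson rtrancl_trans rtrancl_into_rtrancl)+
      then show ?case using step by (auto simp: avoiding_def intro: rtrancl_into_rtrancl)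
    qed auto
    then show False using \<open>(r, s) \<in> E\<^sup>*\<close> s by auto
  qed
  then obtain c where c: "(s, c) \<in> (avoiding E t)\<^sup>*" "(c, t) \<in> E" "c \<noteq> t"
    using assms(2) first_hit_avoiding by metis
  have "(r, c) \<notin> (avoiding E t)\<^sup>*" using c symt s by (meson rtrancl_trans)
  then show ?thesis using that c symt symE' by blast
qed

end

context rooted_tree
begin

lemma connected_nodes_avoiding:
  assumes "(x, y) \<in> (E \<inter> S \<times> S)\<^sup>*" "t \<notin> S"
  shows "(x, y) \<in> (avoiding E t)\<^sup>*"
  by (rule rtrancl_mono[THEN subsetD, OF _ assms(1)]) (use assms(2) in \<open>auto simp: avoiding_def\<close>)

text \<open>
  Cut off a minimal branch \<open>t\<close> whose bags own more than \<open>K\<close> vertices of \<open>U\<close>, by removing the bag of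
  \<open>t\<close>: what remains of the branch falls into sets of at most \<open>K\<close> vertices, which are sparse, and the
  at most \<open>2 d b\<close> arcs lost are paid for by the more than \<open>K\<close> vertices cut off.
\<close>

theorem inner_arcs_decomposition_bound:
  fixes B :: "'t \<Rightarrow> 'a set" and P :: "('a \<times> 'a) set"
  defines "nodes \<equiv> \<lambda>v. {t \<in> N. v \<in> B t}"
  assumes V: "finite V" and sym: "sym P"
    and deg: "\<And>v. v \<in> V \<Longrightarrow> card {u. (v, u) \<in> P} \<le> d" "\<And>v. v \<in> V \<Longrightarrow> finite {u. (v, u) \<in> P}"
    and bags: "\<And>t. t \<in> N \<Longrightarrow> finite (B t) \<and> card (B t) \<le> b"
    and nonempty: "\<And>v. v \<in> V \<Longrightarrow> nodes v \<noteq> {}"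
    and node_conn: "\<And>v x y. v \<in> V \<Longrightarrow> x \<in> nodes v \<Longrightarrow> y \<in> nodes v \<Longrightarrow>
      (x, y) \<in> (E \<inter> nodes v \<times> nodes v)\<^sup>*"
    and edges: "\<And>u v. (u, v) \<in> P \<Longrightarrow> u \<in> V \<Longrightarrow> v \<in> V \<Longrightarrow> nodes u \<inter> nodes v \<noteq> {}"
    and sp: "\<And>S. S \<subseteq> V \<Longrightarrow> card S \<le> K \<Longrightarrow> sparse_arcs P L S"
    and U: "U \<subseteq> V"
  shows "K * L * inner_arcs P U \<le> 2 * K * (L + 1) * card U + 2 * d * b * L * card U"
  using U
\<comment> \<open>The decomposition belongs to \<open>V\<close> and is kept throughout; only
  \<open>U\<close> shrinks.\<close>
proof (induction "card U" arbitrary: U rule: less_induct)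
  case less
  have finU: "finite U" using less.prems V finite_subset by blast
  show ?case
  proof (cases "card U \<le> K")
    case True
    then have "L * inner_arcs P U \<le> 2 * (L + 1) * card U"
      using sp[OF less.prems] by (simp add: sparse_arcs_def)
    then have "K * (L * inner_arcs P U) \<le> K * (2 * (L + 1) * card U)" by (rule mult_le_mono2)
    then show ?thesis by (simp add: algebra_simps)
  next
    case big: False
    define A where "A t = {v \<in> U. nodes v \<subseteq> branch t}" for t
    have finA: "finite (A t)" for t unfolding A_def using finU by simp
    have finbr: "finite (branch t)" for t
      unfolding tree_branch_def using finite_nodes by simp
    let ?T = "\<lambda>t. t \<in> N \<and> K < card (A t)"
    have "A r = U" unfolding A_def branch_root nodes_def by auto
    then have "?T r" using big root by simp
    then obtain t where t: "?T t" and tmin: "\<And>s. ?T s \<Longrightarrow> card (branch t) \<le> card (branch s)"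
      using ex_has_least_nat[of ?T r "\<lambda>t. card (branch t)"] by blast
    define X where "X = U \<inter> B t"
    define A' where "A' = A t - B t"
    \<comment> \<open>Vertices of the bag outside \<open>A t\<close> stay in \<open>W\<close>, so
      that cardinalities add up exactly. Only arcs at the bag are lost, not its vertices.\<close>
    define W where "W = U - A t"
    have A'V: "A' \<subseteq> V" unfolding A'_def A_def using less.prems by auto
    have A'_nodes: "nodes v \<subseteq> branch t" "t \<notin> nodes v" if "v \<in> A'" for v
      using that unfolding A'_def A_def nodes_def by auto
    have node_av: "(x, y) \<in> (avoiding E t)\<^sup>*"
      if "v \<in> V" "t \<notin> nodes v" "x \<in> nodes v" "y \<in> nodes v" for v x y
      using connected_nodes_avoiding node_conn that by metis
    have symt: "\<And>a b. (a, b) \<in> (avoiding E t)\<^sup>* \<Longrightarrow> (b, a) \<in> (avoiding E t)\<^sup>*"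
      using sym_rtrancl_avoiding[OF sym_E] by (auto elim: symE)
    \<comment> \<open>For \<open>v\<close> in \<open>A'\<close>, this is the component of the tree
      without \<open>t\<close> that contains all nodes of \<open>v\<close>. Adjacent vertices share
      a node, so \<open>f\<close> is constant along arcs and its fibres are the pieces left by the
      bag.\<close>
    define f where "f v = (avoiding E t)\<^sup>* `` nodes v" for v
    have f_eq: "f v = (avoiding E t)\<^sup>* `` {s}" if "v \<in> A'" "s \<in> nodes v" for v s
    proof
      have av: "(s, x) \<in> (avoiding E t)\<^sup>*" if "x \<in> nodes v" for x
        using node_av[of v s x] that \<open>v \<in> A'\<close> \<open>s \<in> nodes v\<close> A'V A'_nodes(2) by auto
      show "f v \<subseteq> (avoiding E t)\<^sup>* `` {s}"
        unfolding f_def using av by (auto intro: rtrancl_trans)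
      show "(avoiding E t)\<^sup>* `` {s} \<subseteq> f v" unfolding f_def using that(2) by auto
    qed
    have spA': "sparse_arcs P L A'"
    proof (rule sparse_arcs_fibres[where f = f])
      show "finite A'" unfolding A'_def using finA by simp
      show "f u = f v" if uv: "(u, v) \<in> P" "u \<in> A'" "v \<in> A'" for u v
      proof -
        obtain s where "s \<in> nodes u \<inter> nodes v" using edges[of u v] uv A'V by blast
        then show ?thesis using f_eq uv by auto
      qed
      show "sparse_arcs P L {v \<in> A'. f v = c}" if c: "c \<in> f ` A'" for c
      proof (rule sp)
        show "{v \<in> A'. f v = c} \<subseteq> V" using A'V by auto
        obtain v where v: "v \<in> A'" "c = f v" using c by blast
        then obtain s where s: "s \<in> nodes v" using nonempty A'V by blast
        \<comment> \<open>Each piece lives in the branch of a child \<open>k\<close> of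
          \<open>t\<close>. That branch is smaller, so by the choice of \<open>t\<close> it owns at
          most \<open>K\<close> vertices.\<close>
        obtain k where k: "(t, k) \<in> E" "k \<noteq> t" "(r, k) \<notin> (avoiding E t)\<^sup>*" "(k, s) \<in> (avoiding E t)\<^sup>*"
          using branch_member_child[of s t] A'_nodes[OF v(1)] s by blast
        have c_eq: "c = (avoiding E t)\<^sup>* `` {k}"
          using v(2) f_eq[OF v(1) s] k(4) symt by (auto intro: rtrancl_trans)
        note ch = child_branch[OF k(1-3)]
        have "{v \<in> A'. f v = c} \<subseteq> A k"
        proof
          fix w assume w: "w \<in> {v \<in> A'. f v = c}"
          have "nodes w \<subseteq> f w" unfolding f_def by auto
          with w c_eq ch(1) have "nodes w \<subseteq> branch k" by auto
          then show "w \<in> A k" using w unfolding A'_def A_def by auto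
        qed
        then have "card {v \<in> A'. f v = c} \<le> card (A k)" by (rule card_mono[OF finA])
        moreover have "card (branch k) < card (branch t)"
          by (rule psubset_card_mono[OF finbr ch(2)])
        then have "card (A k) \<le> K" using tmin[of k] k(1) E_sub by force
        ultimately show "card {v \<in> A'. f v = c} \<le> K" by linarith
      qed
    qed
    have AU: "A t \<subseteq> U" unfolding A_def by auto
    have cardU: "card U = card (A t) + card W"
      unfolding W_def using card_Diff_subset[OF finA AU] card_mono[OF finU AU] by simp
    have "card W < card U" using cardU t by linarith
    then have IH: "K * L * inner_arcs P W \<le> 2 * K * (L + 1) * card W + 2 * d * b * L * card W"
      using less.hyps[of W] less.prems unfolding W_def by blast
    have "inner_arcs P U \<le> 2 * d * card X + inner_arcs P A' + inner_arcs P W"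
    proof (rule inner_arcs_remove[OF finU sym])
      \<comment> \<open>An arc from \<open>A'\<close> gives \<open>v\<close> a node inside the
        branch. Unless \<open>t\<close> is a node of \<open>v\<close>, connectivity keeps all its
        nodes in the branch, and then \<open>v\<close> belongs to \<open>A t\<close>.\<close>
      show "v \<in> X \<or> u \<in> X" if uv: "(u, v) \<in> P" "u \<in> A'" "v \<in> W" for u v
      proof (rule ccontr)
        assume neg: "\<not> (v \<in> X \<or> u \<in> X)"
        then have v: "t \<notin> nodes v" "v \<in> U" using uv(3) unfolding X_def W_def nodes_def by auto
        have vV: "v \<in> V" using v less.prems by auto
        obtain s where s: "s \<in> nodes u" "s \<in> nodes v" using edges[OF uv(1)] vV A'V uv(2) by blast
        have "s \<in> branch t" "s \<noteq> t" using A'_nodes[OF uv(2)] s by auto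
        then have rs: "(r, s) \<notin> (avoiding E t)\<^sup>*" by (simp add: tree_branch_def)
        have "nodes v \<subseteq> branch t"
        proof
          fix x assume x: "x \<in> nodes v"
          then have "(x, s) \<in> (avoiding E t)\<^sup>*" using node_av vV v s by blast
          then have "(r, x) \<notin> (avoiding E t)\<^sup>*" using rs by (meson rtrancl_trans)
          then show "x \<in> branch t" using x by (simp add: tree_branch_def nodes_def)
        qed
        then show False using uv(3) v unfolding W_def A_def by auto
      qed
      show "U \<subseteq> X \<union> A' \<union> W" unfolding X_def A'_def W_def by auto
    qed (use deg less.prems finA finU in \<open>auto simp: X_def A'_def W_def\<close>)
    also have "card X \<le> b"
      using bags[of t] t card_mono[of "B t" X] unfolding X_def by auto
    finally have "inner_arcs P U \<le> 2 * d * b + inner_arcs P A' + inner_arcs P W" by simp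
    then have "K * L * inner_arcs P U \<le> K * L * (2 * d * b + inner_arcs P A' + inner_arcs P W)"
      by (rule mult_le_mono2)
    also have "\<dots> = K * (2 * d * b * L) + K * (L * inner_arcs P A') + K * L * inner_arcs P W"
      by (simp add: algebra_simps)
    also have "\<dots> \<le> card (A t) * (2 * d * b * L) + K * (2 * (L + 1) * card (A t)) +
        (2 * K * (L + 1) * card W + 2 * d * b * L * card W)"
    proof (intro add_mono IH mult_le_mono1 mult_le_mono2)
      show "K \<le> card (A t)" using t by simp
      have "card A' \<le> card (A t)" unfolding A'_def by (rule card_mono[OF finA]) auto
      then have "2 * (L + 1) * card A' \<le> 2 * (L + 1) * card (A t)" by (rule mult_le_mono2)
      with spA' show "L * inner_arcs P A' \<le> 2 * (L + 1) * card (A t)"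
        unfolding sparse_arcs_def by (rule le_trans)
    qed
    also have "\<dots> = 2 * K * (L + 1) * card U + 2 * d * b * L * card U"
      unfolding cardU by (simp add: algebra_simps)
    finally show ?thesis .
  qed
qed

end

section \<open>From tree decompositions of digraphs to rooted trees\<close>

lemma parcs_mk_symmetric_sym:
  assumes "sym (arcs_ends G)"
  shows "parcs (mk_symmetric G) = arcs_ends G"
  using assms by (auto simp: parcs_mk_symmetric arcs_ends_conv sym_def image_iff)

lemma connected_rtrancl:
  assumes "Digraph_Component.connected G" "sym (arcs_ends G)" "x \<in> verts G" "y \<in> verts G"
  shows "(x, y) \<in> (arcs_ends G)\<^sup>*"
proof -
  have "x \<rightarrow>\<^sup>*\<^bsub>with_proj (mk_symmetric G)\<^esub> y"
    using assms by (auto simp: connected_def strongly_connected_def)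
  from reachable_rtranclI[OF this] show ?thesis
    using parcs_mk_symmetric_sym[OF assms(2)] by simp
qed

lemma connected_imp_verts_nonempty: "Digraph_Component.connected G \<Longrightarrow> verts G \<noteq> {}"
  by (auto simp: connected_def strongly_connected_def)

lemma arcs_ends_induce_with_proj:
  "arcs_ends (with_proj T \<restriction> S) = parcs T \<inter> S \<times> S"
  by (auto simp: arcs_ends_conv)

text \<open>Only \<open>acyclic_nbrs\<close> needs an argument: a path between two neighbours of
  \<open>t\<close> that misses \<open>t\<close> closes through \<open>t\<close> to a cycle.\<close>

lemma undirected_tree_rooted_tree:
  assumes T: "undirected_tree (with_proj T)" and r: "r \<in> pverts T"
  shows "rooted_tree (pverts T) (parcs T) r"
proof -
  interpret pair_graph T
    using T by (intro pair_graphI_graph) (simp add: undirected_tree_def)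
  have sym: "sym (parcs T)" using sym_arcs by (simp add: symmetric_def)
  show ?thesis
  proof
    show "finite (pverts T)" by (rule pair_finite_verts)
    show "r \<in> pverts T" by (rule r)
    show "sym (parcs T)" by (rule sym)
    show "parcs T \<subseteq> pverts T \<times> pverts T" using in_arcsD1 in_arcsD2 by auto
    show "(r, x) \<in> (parcs T)\<^sup>*" if "x \<in> pverts T" for x
      using connected_rtrancl[of "with_proj T" r x] T sym r that by (simp add: undirected_tree_def)
  next
    fix t c c'
    assume tc: "(t, c) \<in> parcs T" "(t, c') \<in> parcs T" "c \<noteq> t" "c' \<noteq> t"
      and reach: "(c, c') \<in> (avoiding (parcs T) t)\<^sup>*"
    \<comment> \<open>With \<open>t\<close> deleted in a digraph of its own, reachability yields a
      simple path that misses \<open>t\<close>.\<close>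
    define H where "H = \<lparr>pverts = pverts T - {t}, parcs = avoiding (parcs T) t\<rparr>"
    interpret H: pair_wf_digraph H
      by unfold_locales (auto simp: H_def avoiding_def dest: in_arcsD1 in_arcsD2)
    have cH: "c \<in> pverts H" using tc in_arcsD2 by (auto simp: H_def)
    then have "c \<rightarrow>\<^sup>*\<^bsub>with_proj H\<^esub> c'"
      using H.reachable_conv' reach by (simp add: H_def)
    then obtain p where p: "H.apath c p c'" using H.reachable_apath by auto
    have sub: "subgraph (with_proj H) (with_proj T)"
    proof (rule subgraphI)
      show "verts (with_proj H) \<subseteq> verts (with_proj T)" "arcs (with_proj H) \<subseteq> arcs (with_proj T)"
        by (auto simp: H_def avoiding_def)
      show "compatible (with_proj T) (with_proj H)" by (rule compatibleI_with_proj)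
      show "wf_digraph (with_proj H)" by (rule H.wf_digraph)
      show "wf_digraph (with_proj T)" by (rule wf_digraph)
    qed
    have pT: "awalk c p c'" and dist: "distinct (pawalk_verts c p)"
      using subgraph_apath_imp_apath[OF p sub] by (auto simp: apath_def)
    have "set (pawalk_verts c p) \<subseteq> pverts H"
      using p H.awalk_verts_in_verts[of c p c'] by (auto simp: H.apath_def)
    then have t_notin: "t \<notin> set (pawalk_verts c p)" by (auto simp: H_def)
    show "c = c'"
    proof (rule ccontr)
      assume "c \<noteq> c'"
      then have "p \<noteq> []" using pT by (auto simp: awalk_Nil_iff)
      \<comment> \<open>The path is nonempty because \<open>c \<noteq> c'\<close>, so this cycle has
        at least 3 arcs; cycles of length 2 would not contradict
        \<open>undirected_tree\<close>.\<close>
      let ?q = "(t, c) # p @ [(c', t)]"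
      have ct: "(c', t) \<in> parcs T" using tc sym by (auto elim: symE)
      have last: "awalk c' [(c', t)] t" using ct by (auto simp: awalk_simps dest: in_arcsD2)
      have aw: "awalk c (p @ [(c', t)]) t" using pT last by (rule awalk_appendI)
      moreover have "pawalk_verts c (p @ [(c', t)]) = pawalk_verts c p @ [t]"
        using awalk_verts_append[of c p "[(c', t)]" t] pT aw by simp
      moreover have "awalk t ?q t" using aw tc(1) by (simp only: awalk_Cons_iff fst_conv snd_conv simp_thms)
      ultimately have "cycle ?q"
        unfolding cycle_def using dist t_notin by (intro exI[of _ t]) auto
      moreover have "length ?q \<ge> 3" using \<open>p \<noteq> []\<close> by (cases p) auto
      ultimately show False using T unfolding undirected_tree_def by blast
    qed
  qed
qed

lemma tree_decomposition_inner_arcs_bound: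
  fixes H :: "('a, 'b) pre_digraph" and T :: "'t pair_pre_digraph"
  assumes TB: "tree_decomposition H (with_proj T) B"
    and fin: "finite (verts H)" and sym: "sym (arcs_ends H)"
    and deg: "\<And>v. v \<in> verts H \<Longrightarrow> card {u. (v, u) \<in> arcs_ends H} \<le> d"
      "\<And>v. v \<in> verts H \<Longrightarrow> finite {u. (v, u) \<in> arcs_ends H}"
    and sp: "\<And>S. S \<subseteq> verts H \<Longrightarrow> card S \<le> K \<Longrightarrow> sparse_arcs (arcs_ends H) L S"
    and U: "U \<subseteq> verts H"
  shows "K * L * inner_arcs (arcs_ends H) U \<le> 2 * K * (L + 1) * card U +
    2 * d * (decomposition_width (with_proj T) B + 1) * L * card U"
proof -
  let ?E = "parcs T"
  from TB have T: "undirected_tree (with_proj T)"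
    and verts: "(\<Union>t\<in>pverts T. B t) = verts H"
    and arcs: "\<And>u v. (u, v) \<in> arcs_ends H \<Longrightarrow> \<exists>t\<in>pverts T. u \<in> B t \<and> v \<in> B t"
    and node_conn: "\<And>v. v \<in> verts H \<Longrightarrow> Digraph_Component.connected (with_proj T \<restriction> {t \<in> pverts T. v \<in> B t})"
    by (auto simp: tree_decomposition_def)
  have "pverts T \<noteq> {}" using T connected_imp_verts_nonempty[of "with_proj T"]
    by (auto simp: undirected_tree_def)
  then obtain r where r: "r \<in> pverts T" by blast
  interpret rooted_tree "pverts T" ?E r
    by (rule undirected_tree_rooted_tree[OF T r])
  show ?thesis
  proof (rule inner_arcs_decomposition_bound[OF fin sym deg])
    fix t assume t: "t \<in> pverts T"
    \<comment> \<open>The \<open>+ 1\<close> makes up for the subtraction in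
      \<open>decomposition_width\<close>, also where it truncates because all bags are
      empty.\<close>
    have "card (B t) \<le> Max ((\<lambda>t. card (B t)) ` pverts T)"
      using t finite_nodes by (intro Max_ge) auto
    moreover have "finite (B t)" using verts t fin by (metis UN_upper finite_subset)
    ultimately show "finite (B t) \<and> card (B t) \<le> decomposition_width (with_proj T) B + 1"
      unfolding decomposition_width_def by simp
  next
    fix v assume "v \<in> verts H"
    then show "{t \<in> pverts T. v \<in> B t} \<noteq> {}" using verts by auto
  next
    fix v x y
    assume v: "v \<in> verts H" and xy: "x \<in> {t \<in> pverts T. v \<in> B t}" "y \<in> {t \<in> pverts T. v \<in> B t}"
    have sym': "sym (?E \<inter> {t \<in> pverts T. v \<in> B t} \<times> {t \<in> pverts T. v \<in> B t})"
      using sym_E by (auto simp: sym_def)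
    show "(x, y) \<in> (?E \<inter> {t \<in> pverts T. v \<in> B t} \<times> {t \<in> pverts T. v \<in> B t})\<^sup>*"
      using connected_rtrancl[OF node_conn[OF v], of x y] xy sym'
      unfolding arcs_ends_induce_with_proj by simp
  next
    fix u v assume "(u, v) \<in> arcs_ends H"
    then show "{t \<in> pverts T. u \<in> B t} \<inter> {t \<in> pverts T. v \<in> B t} \<noteq> {}" using arcs by auto
  qed (use sp U in auto)
qed

text \<open>One node whose bag is the whole vertex set. Some witness must exist before the
  \<open>LEAST\<close> in \<open>treewidth\<close> says anything.\<close>

lemma ex_tree_decomposition:
  fixes G :: "('a, 'b) pre_digraph"
  assumes "wf_digraph G"
  shows "\<exists>(T :: nat pair_pre_digraph) B. tree_decomposition G (with_proj T) B"
proof -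
  interpret wf_digraph G by fact
  define T :: "nat pair_pre_digraph" where "T = \<lparr>pverts = {0}, parcs = {}\<rparr>"
  interpret T: pair_graph T
    by unfold_locales (auto simp: T_def symmetric_def sym_def)
  have conn: "Digraph_Component.connected (with_proj T)"
  proof -
    have "pair_wf_digraph (mk_symmetric (with_proj T))" by (rule T.wellformed_mk_symmetric)
    then interpret S: pair_wf_digraph "mk_symmetric (with_proj T)" .
    have "0 \<rightarrow>\<^sup>*\<^bsub>with_proj (mk_symmetric (with_proj T))\<^esub> 0"
      by (rule S.reachable_refl) (simp add: T_def)
    then show ?thesis by (simp add: connected_def strongly_connected_def T_def)
  qed
  have "\<not> T.cycle p" for p
    by (auto simp: pre_digraph.cycle_def pre_digraph.awalk_def T_def)
  then have "undirected_tree (with_proj T)"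
    using conn T.graph_axioms T.pair_graphD_graph by (simp add: undirected_tree_def)
  moreover have "with_proj T \<restriction> {0} = with_proj T"
    by (simp add: induce_subgraph_def with_proj_def T_def)
  moreover have "pverts T = {0}" by (simp add: T_def)
  ultimately have "tree_decomposition G (with_proj T) (\<lambda>_. verts G)"
    using conn adj_in_verts by (auto simp: tree_decomposition_def)
  then show ?thesis by blast
qed

lemma treewidth_attained:
  fixes G :: "('a, 'b) pre_digraph"
  assumes "wf_digraph G"
  obtains T :: "nat pair_pre_digraph" and B
  where "tree_decomposition G (with_proj T) B" "decomposition_width (with_proj T) B = treewidth G"
proof -
  let ?P = "\<lambda>w. \<exists>(T :: nat pair_pre_digraph) B.
    tree_decomposition G (with_proj T) B \<and> decomposition_width (with_proj T) B = w"
  have "\<exists>w. ?P w" using ex_tree_decomposition[OF assms] by blast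
  then have "?P (treewidth G)" unfolding treewidth_def by (rule LeastI_ex)
  then show ?thesis using that by blast
qed

section \<open>Random lifts\<close>

text \<open>Induction on the prescribed pairs: following \<sigma> by the transposition of
  \<open>a\<close> and \<open>b\<close>, where \<sigma> maps \<open>a\<close> to \<open>b\<close>,
  gives a permutation that fixes \<open>a\<close>, hence one of \<open>X - {a}\<close>, and the
  other prescriptions are renamed accordingly.\<close>

lemma card_permutes_extending_le:
  assumes "finite X" "F \<subseteq> X \<times> X"
  shows "card {\<sigma>. \<sigma> permutes X \<and> (\<forall>(x, y)\<in>F. \<sigma> x = y)} \<le> fact (card X - card F)"
  using assms
proof (induction "card F" arbitrary: F X)
  case 0
  then have "F = {}" using finite_subset[OF 0(3)] by simp
  then show ?case using card_permutations[OF refl \<open>finite X\<close>] by simp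
next
  case (Suc k)
  let ?P = "\<lambda>X F. {\<sigma>. \<sigma> permutes X \<and> (\<forall>(x, y)\<in>F. \<sigma> x = y)}"
  show ?case
  proof (cases "?P X F = {}")
    \<comment> \<open>Contradictory prescriptions end here. In the other case \<rho> certifies that
      \<open>F\<close> is part of the graph of an injection.\<close>
    case True
    then show ?thesis by (simp only: card.empty le0)
  next
    case False
    then obtain \<rho> where "\<rho> \<in> ?P X F" by blast
    then have \<rho>: "\<rho> permutes X" "\<And>x y. (x, y) \<in> F \<Longrightarrow> \<rho> x = y" by auto
    have finF: "finite F" using Suc.hyps(2) by (metis card.infinite nat.distinct(1))
    have "F \<noteq> {}" using Suc.hyps(2) by auto
    then obtain e where "e \<in> F" by blast
    then obtain a b where ab: "(a, b) \<in> F" by (cases e) auto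
    define F' where "F' = F - {(a, b)}"
    define t where "t = Transposition.transpose a b"
    define F'' where "F'' = map_prod id t ` F'"
    have aX: "a \<in> X" "b \<in> X" using ab Suc.prems by auto
    have F': "x \<noteq> a" "y \<noteq> b" if "(x, y) \<in> F'" for x y
    proof -
      have "\<rho> x = y" "\<rho> a = b" "(x, y) \<noteq> (a, b)" using that ab \<rho>(2) unfolding F'_def by auto
      then show "x \<noteq> a" "y \<noteq> b" using injD[OF permutes_inj[OF \<rho>(1)], of x a] by auto
    qed
    have tinj: "inj (map_prod id t)"
      unfolding t_def by (rule prod.inj_map[OF inj_on_id inj_transpose])
    have "card F'' = card F'" unfolding F''_def using card_image inj_on_subset[OF tinj subset_UNIV] by blast
    then have cardF'': "card F'' = k" using Suc.hyps(2) ab finF unfolding F'_def by simp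
    have "F'' \<subseteq> (X - {a}) \<times> (X - {a})"
    proof
      fix e assume "e \<in> F''"
      then obtain x y where xy: "e = (x, t y)" "(x, y) \<in> F'" unfolding F''_def by auto
      then have "x \<in> X" "y \<in> X" using Suc.prems unfolding F'_def by auto
      moreover have "t y \<noteq> a" "t y \<in> X"
        using F'[OF xy(2)] aX \<open>y \<in> X\<close> unfolding t_def Transposition.transpose_def by auto
      ultimately show "e \<in> (X - {a}) \<times> (X - {a})" using xy F'[OF xy(2)] by auto
    qed
    then have IH: "card (?P (X - {a}) F'') \<le> fact (card (X - {a}) - k)"
      using Suc.hyps(1)[of F'' "X - {a}"] cardF'' Suc.prems by simp
    have "(\<lambda>\<sigma>. t \<circ> \<sigma>) ` ?P X F \<subseteq> ?P (X - {a}) F''"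
    proof
      fix \<tau> assume "\<tau> \<in> (\<lambda>\<sigma>. t \<circ> \<sigma>) ` ?P X F"
      then obtain \<sigma> where "\<tau> = t \<circ> \<sigma>" "\<sigma> \<in> ?P X F" by blast
      then have \<sigma>: "\<tau> = t \<circ> \<sigma>" "\<sigma> permutes X" "\<And>x y. (x, y) \<in> F \<Longrightarrow> \<sigma> x = y" by auto
      have "\<sigma> permutes insert a (X - {a})" using \<sigma>(2) aX by (simp add: insert_absorb)
      from permutes_insert_lemma[OF this] have "\<tau> permutes X - {a}"
        unfolding \<sigma>(1) t_def \<sigma>(3)[OF ab] .
      moreover have "\<forall>(x, y)\<in>F''. \<tau> x = y"
        using \<sigma>(1,3) unfolding F''_def F'_def by auto
      ultimately show "\<tau> \<in> ?P (X - {a}) F''" by blast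
    qed
    moreover have "inj_on (\<lambda>\<sigma>. t \<circ> \<sigma>) (?P X F)"
      unfolding t_def by (rule inj_on_subset[OF fun.inj_map[OF inj_transpose] subset_UNIV])
    moreover have "finite (?P (X - {a}) F'')"
      by (rule finite_subset[OF _ finite_permutations[of "X - {a}"]]) (use Suc.prems in auto)
    ultimately have "card (?P X F) \<le> card (?P (X - {a}) F'')" by (meson card_inj_on_le)
    also note IH
    also have "card (X - {a}) - k = card X - card F" using Suc.hyps(2) aX Suc.prems by simp
    finally show ?thesis .
  qed
qed

text \<open>Each of the \<open>f\<close> factors dropped from the factorial of \<open>m\<close> is
  at least \<open>m / 2\<close>.\<close>

lemma fact_diff_le:
  assumes "2 * f \<le> m" "0 < m"
  shows "fact (m - f) \<le> fact m * (2 / real m) ^ f"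
  using assms
proof (induction f)
  case (Suc f)
  then have IH: "fact (m - f) \<le> fact m * (2 / real m) ^ f" by simp
  have "m - f = Suc (m - Suc f)" using Suc.prems by simp
  then have "fact (m - f) = real (m - f) * fact (m - Suc f)" by (metis fact_Suc of_nat_fact of_nat_mult)
  moreover have "real m / 2 \<le> real (m - f)" using Suc.prems by (simp add: of_nat_diff)
  ultimately have "real m / 2 * fact (m - Suc f) \<le> fact (m - f)" by (simp add: mult_right_mono)
  then have "fact (m - Suc f) \<le> 2 / real m * fact (m - f)" using Suc.prems by (simp add: field_simps)
  also have "\<dots> \<le> 2 / real m * (fact m * (2 / real m) ^ f)" by (intro mult_left_mono IH) simp
  finally show ?case by (simp add: mult_ac)
qed simp

lemma card_permutes_extending_bound:
  assumes "finite X" "F \<subseteq> X \<times> X" "2 * card F \<le> card X" "card X > 0"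
  shows "real (card {\<sigma>. \<sigma> permutes X \<and> (\<forall>(x, y)\<in>F. \<sigma> x = y)})
    \<le> fact (card X) * (2 / card X) ^ card F"
proof -
  have "real (card {\<sigma>. \<sigma> permutes X \<and> (\<forall>(x, y)\<in>F. \<sigma> x = y)}) \<le> real (fact (card X - card F))"
    by (rule of_nat_mono[OF card_permutes_extending_le[OF assms(1,2)]])
  also have "\<dots> \<le> fact (card X) * (2 / card X) ^ card F"
    using fact_diff_le[OF assms(3,4)] by simp
  finally show ?thesis .
qed

text \<open>Up to division by the factorial, the left side is a single term of the series for
  \<open>exp n\<close>, and e is at most 3.\<close>

lemma power_self_le_fact: "real n ^ n \<le> 3 ^ n * fact n"
proof -
  have "(\<Sum>k\<in>{n}. inverse (fact k) *\<^sub>R real n ^ k) \<le> (\<Sum>k. inverse (fact k) *\<^sub>R real n ^ k)"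
    by (rule sum_le_suminf[OF summable_exp_generic]) auto
  then have "real n ^ n / fact n \<le> exp (real n)" by (simp add: exp_def field_simps)
  also have "\<dots> = exp 1 ^ n" by (simp flip: exp_of_nat_mult)
  also have "\<dots> \<le> 3 ^ n" by (intro power_mono exp_le) simp
  finally show ?thesis by (simp add: field_simps)
qed

lemma binomial_le_pow_div:
  assumes "k > 0"
  shows "real (n choose k) \<le> (3 * real n / real k) ^ k"
proof -
  have "real (n choose k) * real k ^ k \<le> real (n choose k) * (3 ^ k * fact k)"
    by (intro mult_left_mono power_self_le_fact) simp
  also have "\<dots> = 3 ^ k * real ((n choose k) * fact k)" by simp
  also have "\<dots> \<le> 3 ^ k * real (n ^ k)"
    by (intro mult_left_mono of_nat_mono binomial_fact_pow) simp
  finally show ?thesis using assms by (simp add: power_divide power_mult_distrib field_simps)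
qed

text \<open>The factors count the vertex sets of size \<open>s\<close>, the choices of
  \<open>k\<close> pairs in one of them, and bound the probability that a lift contains these pairs.
  Since \<open>s \<le> L * (k - s)\<close>, the surplus of pairs over vertices beats every factor
  exponential in \<open>s\<close>.\<close>

lemma first_moment_term:
  fixes s m k :: nat
  assumes s: "s \<ge> 1" and m: "m \<ge> 1" and k: "s \<le> k" "s \<le> L * (k - s)"
    and small: "6 * real s / real m \<le> (1 / 432) ^ L"
  shows "real (6 * m choose s) * real (s ^ 2 choose k) * (2 / real m) ^ k \<le> (1 / 4) ^ s"
proof -
  have "real (s ^ 2 choose k) \<le> (3 * real (s ^ 2) / real k) ^ k"
    by (rule binomial_le_pow_div) (use s k in simp)
  also have "\<dots> \<le> (3 * real s) ^ k"
  proof (rule power_mono)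
    have "real s * real s \<le> real s * real k" using k by (intro mult_left_mono) auto
    then show "3 * real (s\<^sup>2) / real k \<le> 3 * real s"
      using s k by (simp add: field_simps power2_eq_square)
  qed simp
  finally have 2: "real (s ^ 2 choose k) \<le> (3 * real s) ^ k" .
  have 1: "real (6 * m choose s) \<le> (18 * real m / real s) ^ s"
    using binomial_le_pow_div[of s "6 * m"] s by simp
  have "real (6 * m choose s) * real (s ^ 2 choose k) * (2 / real m) ^ k
      \<le> (18 * real m / real s) ^ s * (3 * real s) ^ k * (2 / real m) ^ k"
    by (intro mult_mono 1 2 order_refl) auto
  also have "\<dots> = (18 * real m / real s) ^ s * (3 * real s * (2 / real m)) ^ k"
    by (simp only: power_mult_distrib mult.assoc)
  also have "3 * real s * (2 / real m) = 6 * real s / real m" by simp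
  \<comment> \<open>Splitting off \<open>s\<close> of the \<open>k\<close> factors cancels
    \<open>m / s\<close> and leaves 18 * 6 = 108 per vertex; 432 is 4 * 108, so that a factor 1/4
    per vertex remains.\<close>
  also have "(6 * real s / real m) ^ k = (6 * real s / real m) ^ s * (6 * real s / real m) ^ (k - s)"
    using k by (metis le_add_diff_inverse power_add)
  also have "(18 * real m / real s) ^ s * ((6 * real s / real m) ^ s * (6 * real s / real m) ^ (k - s)) =
      (18 * real m / real s * (6 * real s / real m)) ^ s * (6 * real s / real m) ^ (k - s)"
    by (simp only: power_mult_distrib mult.assoc)
  also have "18 * real m / real s * (6 * real s / real m) = 108" using s m by simp
  also have "108 ^ s * (6 * real s / real m) ^ (k - s) \<le> 108 ^ s * (1 / 432) ^ s"
  proof (rule mult_left_mono)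
    have "(6 * real s / real m) ^ (k - s) \<le> ((1 / 432) ^ L) ^ (k - s)"
      by (rule power_mono[OF small]) simp
    also have "\<dots> = (1 / 432 :: real) ^ (L * (k - s))" by (simp only: power_mult)
    also have "\<dots> \<le> (1 / 432) ^ s" by (rule power_decreasing[OF k(2)]) auto
    finally show "(6 * real s / real m) ^ (k - s) \<le> (1 / 432) ^ s" .
  qed simp
  also have "\<dots> = (108 * (1 / 432)) ^ s" by (simp only: power_mult_distrib)
  also have "\<dots> = (1 / 4 :: real) ^ s" by simp
  finally show ?thesis .
qed

text \<open>
  The random graph is a lift of \<open>K\<^sub>3\<^sub>,\<^sub>3\<close>: the vertex \<open>i + 6 x\<close> is the copy number \<open>x < m\<close> of the vertex
  \<open>i < 6\<close>, the classes being \<open>{0, 1, 2}\<close> and \<open>{3, 4, 5}\<close>, and the copies of \<open>i\<close> and \<open>j\<close> are matched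
  by the permutation \<open>\<sigma> (i, j)\<close>.  Such a lift has neither parallel edges nor triangles.
\<close>

definition lift_index :: "(nat \<times> nat) set" where
  "lift_index = {..<3} \<times> {3..<6}"

definition lifts :: "nat \<Rightarrow> (nat \<times> nat \<Rightarrow> nat \<Rightarrow> nat) set" where
  "lifts m = lift_index \<rightarrow>\<^sub>E {\<sigma>. \<sigma> permutes {..<m}}"

definition lift_sides :: "nat \<Rightarrow> (nat \<times> nat) set" where
  "lift_sides m = {a. a < 6 * m \<and> a mod 6 < 3} \<times> {b. b < 6 * m \<and> 3 \<le> b mod 6}"

text \<open>Each edge is listed once, directed from the class of 0, 1, 2 to that of 3, 4, 5, so the
  counts below are of edges rather than arcs.\<close>

definition lift_edges :: "nat \<Rightarrow> (nat \<times> nat \<Rightarrow> nat \<Rightarrow> nat) \<Rightarrow> (nat \<times> nat) set" where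
  "lift_edges m \<sigma> = {(a, b) \<in> lift_sides m. \<sigma> (a mod 6, b mod 6) (a div 6) = b div 6}"

definition lift_graph :: "nat \<Rightarrow> (nat \<times> nat \<Rightarrow> nat \<Rightarrow> nat) \<Rightarrow> nat pair_pre_digraph" where
  "lift_graph m \<sigma> = \<lparr>pverts = {..<6 * m}, parcs = lift_edges m \<sigma> \<union> (lift_edges m \<sigma>)\<inverse>\<rparr>"

lemma card_lift_index: "finite lift_index" "card lift_index = 9"
  by (simp_all add: lift_index_def)

lemma finite_lifts: "finite (lifts m)"
  unfolding lifts_def by (intro finite_PiE card_lift_index finite_permutations) simp

lemma card_lifts: "card (lifts m) = fact m ^ 9"
  unfolding lifts_def by (simp add: card_PiE card_lift_index card_permutations)

lemma lifts_permutes: "\<sigma> \<in> lifts m \<Longrightarrow> i < 3 \<Longrightarrow> 3 \<le> j \<Longrightarrow> j < 6 \<Longrightarrow> \<sigma> (i, j) permutes {..<m}"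
  by (auto simp: lifts_def lift_index_def PiE_iff)

lemma index_less: "i < 6 \<Longrightarrow> x < m \<Longrightarrow> i + 6 * x < 6 * (m :: nat)"
  by linarith

lemma lift_nbrs_left:
  assumes \<sigma>: "\<sigma> \<in> lifts m" and a: "a < 6 * m" "a mod 6 < 3"
  shows "{b. (a, b) \<in> lift_edges m \<sigma>} = (\<lambda>j. j + 6 * \<sigma> (a mod 6, j) (a div 6)) ` {3..<6}"
proof (intro equalityI subsetI)
  fix b assume "b \<in> {b. (a, b) \<in> lift_edges m \<sigma>}"
  then have "3 \<le> b mod 6" "\<sigma> (a mod 6, b mod 6) (a div 6) = b div 6"
    by (auto simp: lift_edges_def lift_sides_def)
  then show "b \<in> (\<lambda>j. j + 6 * \<sigma> (a mod 6, j) (a div 6)) ` {3..<6}"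
    by (intro image_eqI[of _ _ "b mod 6"]) auto
next
  fix b assume "b \<in> (\<lambda>j. j + 6 * \<sigma> (a mod 6, j) (a div 6)) ` {3..<6}"
  then obtain j where j: "3 \<le> j" "j < 6" "b = j + 6 * \<sigma> (a mod 6, j) (a div 6)" by auto
  have "\<sigma> (a mod 6, j) permutes {..<m}" using lifts_permutes \<sigma> a j by blast
  moreover have "a div 6 < m" using a by auto
  ultimately have "\<sigma> (a mod 6, j) (a div 6) < m" using permutes_in_image by fastforce
  then have "b < 6 * m" using j index_less by blast
  then show "b \<in> {b. (a, b) \<in> lift_edges m \<sigma>}"
    using a j by (auto simp: lift_edges_def lift_sides_def)
qed

lemma lift_nbrs_right:
  assumes \<sigma>: "\<sigma> \<in> lifts m" and b: "b < 6 * m" "3 \<le> b mod 6"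
  shows "{a. (a, b) \<in> lift_edges m \<sigma>} = (\<lambda>i. i + 6 * inv (\<sigma> (i, b mod 6)) (b div 6)) ` {..<3}"
proof (intro equalityI subsetI)
  fix a assume "a \<in> {a. (a, b) \<in> lift_edges m \<sigma>}"
  then have a: "a mod 6 < 3" "\<sigma> (a mod 6, b mod 6) (a div 6) = b div 6"
    by (auto simp: lift_edges_def lift_sides_def)
  have "\<sigma> (a mod 6, b mod 6) permutes {..<m}" using lifts_permutes \<sigma> a b by simp
  then have "inv (\<sigma> (a mod 6, b mod 6)) (b div 6) = a div 6"
    using a(2) by (metis permutes_inverses(2))
  then show "a \<in> (\<lambda>i. i + 6 * inv (\<sigma> (i, b mod 6)) (b div 6)) ` {..<3}"
    using a by (intro image_eqI[of _ _ "a mod 6"]) auto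
next
  fix a assume "a \<in> (\<lambda>i. i + 6 * inv (\<sigma> (i, b mod 6)) (b div 6)) ` {..<3}"
  then obtain i where i: "i < 3" "a = i + 6 * inv (\<sigma> (i, b mod 6)) (b div 6)" by auto
  have p: "\<sigma> (i, b mod 6) permutes {..<m}" using lifts_permutes \<sigma> i b by simp
  moreover have "b div 6 < m" using b by auto
  ultimately have "inv (\<sigma> (i, b mod 6)) (b div 6) < m"
    using permutes_in_image[OF permutes_inv[OF p]] by fastforce
  then have "a < 6 * m" using i index_less[of i] by simp
  then show "a \<in> {a. (a, b) \<in> lift_edges m \<sigma>}"
    using b i permutes_inverses(1)[OF p] by (auto simp: lift_edges_def lift_sides_def)
qed

lemma inj_on_add_mult_6: "A \<subseteq> {..<6} \<Longrightarrow> inj_on (\<lambda>j. j + 6 * f j) (A :: nat set)"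
proof (rule inj_onI)
  fix x y assume "A \<subseteq> {..<6}" "x \<in> A" "y \<in> A" and e: "x + 6 * f x = y + 6 * f y"
  then have "x < 6" "y < 6" by auto
  moreover have "(x + 6 * f x) mod 6 = (y + 6 * f y) mod 6" using e by simp
  ultimately show "x = y" by simp
qed

lemma lift_graph_regular:
  assumes \<sigma>: "\<sigma> \<in> lifts m"
  shows "regular_graph 3 (with_proj (lift_graph m \<sigma>))"
proof -
  let ?G = "lift_graph m \<sigma>"
  have sub: "lift_edges m \<sigma> \<subseteq> lift_sides m" by (auto simp: lift_edges_def)
  have fin: "finite (lift_edges m \<sigma>)"
    by (rule finite_subset[OF sub]) (simp add: lift_sides_def)
  interpret pair_graph ?G
    by unfold_locales
      (use sub fin in \<open>auto simp: lift_graph_def lift_sides_def symmetric_def sym_def\<close>)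
  have card3: "card ((\<lambda>j. j + 6 * f j) ` {3..<6}) = 3" "card ((\<lambda>j. j + 6 * f j) ` {..<3}) = 3"
    for f :: "nat \<Rightarrow> nat"
  proof -
    have "{3..<6} \<subseteq> {..<6 :: nat}" "{..<3} \<subseteq> {..<6 :: nat}" by auto
    from this[THEN inj_on_add_mult_6, THEN card_image]
    show "card ((\<lambda>j. j + 6 * f j) ` {3..<6}) = 3" "card ((\<lambda>j. j + 6 * f j) ` {..<3}) = 3" by auto
  qed
  have "card {b. (a, b) \<in> parcs ?G} = 3" if a: "a < 6 * m" for a
  proof (cases "a mod 6 < 3")
    case True
    then have "{b. (a, b) \<in> parcs ?G} = {b. (a, b) \<in> lift_edges m \<sigma>}"
      using sub by (auto simp: lift_graph_def lift_sides_def)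
    then show ?thesis
      unfolding lift_nbrs_left[OF \<sigma> a True] by (simp only: card3)
  next
    case False
    then have "{b. (a, b) \<in> parcs ?G} = {b. (b, a) \<in> lift_edges m \<sigma>}"
      using sub by (auto simp: lift_graph_def lift_sides_def)
    moreover have "3 \<le> a mod 6" using False by simp
    ultimately show ?thesis
      using lift_nbrs_right[OF \<sigma> a] by (simp only: card3)
  qed
  moreover have "out_arcs (with_proj ?G) a = Pair a ` {b. (a, b) \<in> parcs ?G}" for a
    by (auto simp: out_arcs_def)
  ultimately have "out_degree (with_proj ?G) a = 3" if "a \<in> pverts ?G" for a
    using that by (simp add: out_degree_def card_image inj_on_def lift_graph_def)
  then show ?thesis using pair_graphD_graph by (simp add: regular_graph_def)
qed

text \<open>
  Distinct entries of \<open>\<sigma>\<close> are independent, and each prescribed value of a permutation costs a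
  factor of at most \<open>2 / m\<close>.
\<close>

lemma card_lifts_containing:
  assumes F: "F \<subseteq> lift_sides m" and m: "m \<ge> 1" and cF: "2 * card F \<le> m"
  shows "real (card {\<sigma> \<in> lifts m. F \<subseteq> lift_edges m \<sigma>}) \<le> fact m ^ 9 * (2 / real m) ^ card F"
proof -
  \<comment> \<open>\<open>cls\<close> names the permutation that an edge constrains, and
    \<open>crd\<close> the argument and value it prescribes. Within one class \<open>crd\<close> is
    injective.\<close>
  define cls where "cls = (\<lambda>(a :: nat, b :: nat). (a mod 6, b mod 6))"
  define crd where "crd = (\<lambda>(a :: nat, b :: nat). (a div 6, b div 6))"
  define Fi where "Fi p = {e \<in> F. cls e = p}" for p
  have finF: "finite F" by (rule finite_subset[OF F]) (simp add: lift_sides_def)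
  have injc: "inj_on crd (Fi p)" for p
  proof (rule inj_onI)
    fix e e' assume e: "e \<in> Fi p" "e' \<in> Fi p" "crd e = crd e'"
    obtain a b a' b' where ab: "e = (a, b)" "e' = (a', b')" by (metis surj_pair)
    then have "a mod 6 = a' mod 6" "b mod 6 = b' mod 6" "a div 6 = a' div 6" "b div 6 = b' div 6"
      using e by (auto simp: Fi_def cls_def crd_def)
    then show "e = e'" using ab by (metis div_mult_mod_eq)
  qed
  have cFi: "card (crd ` Fi p) = card (Fi p)" "card (Fi p) \<le> card F" for p
  proof -
    show "card (crd ` Fi p) = card (Fi p)" by (rule card_image[OF injc])
    show "card (Fi p) \<le> card F" by (rule card_mono[OF finF]) (auto simp: Fi_def)
  qed
  have subFi: "crd ` Fi p \<subseteq> {..<m} \<times> {..<m}" for p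
    using F by (fastforce simp: Fi_def crd_def lift_sides_def)
  have clsF: "cls e \<in> lift_index" if "e \<in> F" for e
    using that F by (auto simp: cls_def lift_index_def lift_sides_def)
  have cF_sum: "card F = (\<Sum>p\<in>lift_index. card (Fi p))"
  proof -
    have "F = (\<Union>p\<in>lift_index. Fi p)" using clsF by (auto simp: Fi_def)
    then have "card F = card (\<Union>p\<in>lift_index. Fi p)" by simp
    also have "\<dots> = (\<Sum>p\<in>lift_index. card (Fi p))"
      by (rule card_UN_disjoint) (use finF card_lift_index in \<open>auto simp: Fi_def\<close>)
    finally show ?thesis .
  qed
  let ?P = "\<lambda>p. {\<tau>. \<tau> permutes {..<m} \<and> (\<forall>(x, y)\<in>crd ` Fi p. \<tau> x = y)}"
  have finP: "finite (?P p)" for p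
    by (rule finite_subset[OF _ finite_permutations[of "{..<m}"]]) auto
  have "{\<sigma> \<in> lifts m. F \<subseteq> lift_edges m \<sigma>} \<subseteq> PiE lift_index ?P"
  proof
    fix \<sigma> assume \<sigma>: "\<sigma> \<in> {\<sigma> \<in> lifts m. F \<subseteq> lift_edges m \<sigma>}"
    have "\<sigma> p x = y" if "(x, y) \<in> crd ` Fi p" for p x y
      using that \<sigma> by (auto simp: Fi_def crd_def cls_def lift_edges_def)
    then have "\<forall>(x, y)\<in>crd ` Fi p. \<sigma> p x = y" for p by blast
    then show "\<sigma> \<in> PiE lift_index ?P" using \<sigma> by (simp add: lifts_def PiE_iff)
  qed
  then have "card {\<sigma> \<in> lifts m. F \<subseteq> lift_edges m \<sigma>} \<le> card (PiE lift_index ?P)"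
    by (rule card_mono[rotated]) (intro finite_PiE card_lift_index finP)
  also have "\<dots> = (\<Prod>p\<in>lift_index. card (?P p))" by (simp add: card_PiE card_lift_index)
  finally have "real (card {\<sigma> \<in> lifts m. F \<subseteq> lift_edges m \<sigma>}) \<le> real (\<Prod>p\<in>lift_index. card (?P p))"
    by (rule of_nat_mono)
  also have "\<dots> = (\<Prod>p\<in>lift_index. real (card (?P p)))" by (rule of_nat_prod)
  also have "\<dots> \<le> (\<Prod>p\<in>lift_index. fact m * (2 / real m) ^ card (Fi p))"
  proof (intro prod_mono conjI)
    fix p
    have "2 * card (Fi p) \<le> m" using cFi(2)[of p] cF by linarith
    then show "real (card (?P p)) \<le> fact m * (2 / real m) ^ card (Fi p)"
      using card_permutes_extending_bound[of "{..<m}" "crd ` Fi p"] subFi[of p] m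
      by (simp add: cFi(1))
  qed simp
  also have "\<dots> = fact m ^ 9 * (2 / real m) ^ card F"
    unfolding cF_sum by (simp add: prod.distrib card_lift_index power_sum)
  finally show ?thesis .
qed

text \<open>Union bound over the sets \<open>S\<close> and over the ways to prescribe
  \<open>k\<close> edges inside \<open>S\<close>.\<close>

lemma card_lifts_dense_set:
  assumes s: "s \<ge> 1" and m: "m \<ge> 1" and L: "L \<ge> 1"
    and small: "6 * real s / real m \<le> (1 / 432) ^ L"
  shows "real (card {\<sigma> \<in> lifts m. \<exists>S\<subseteq>{..<6 * m}. card S = s \<and> s + s div L < card (lift_edges m \<sigma> \<inter> S \<times> S)})
    \<le> fact m ^ 9 * (1 / 4) ^ s"
proof -
  \<comment> \<open>The least number of edges violating the bound. The rounding is favourable: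
    \<open>k - s\<close> exceeds \<open>s / L\<close>.\<close>
  define k where "k = s + s div L + 1"
  have "s < L * (s div L + 1)" using L by (metis Suc_eq_plus1 dividend_less_times_div less_le_trans mult_Suc_right order_refl add.commute zero_less_one)
  then have k: "s \<le> k" "s \<le> L * (k - s)" by (simp_all add: k_def)
  have "s div L \<le> s" by simp
  then have "k \<le> s + s + s" unfolding k_def by (intro add_mono s order_refl)
  then have "2 * k \<le> 6 * s" by linarith
  moreover have "6 * s \<le> m"
  proof -
    have "6 * real s / real m \<le> 1" using small power_le_one[of "1 / 432 :: real" L] by simp
    then show ?thesis using m by (simp add: field_simps)
  qed
  ultimately have km: "2 * k \<le> m" by linarith
  let ?SS = "{S. S \<subseteq> {..<6 * m} \<and> card S = s}"
  let ?FF = "\<lambda>S. {F. F \<subseteq> lift_sides m \<inter> S \<times> S \<and> card F = k}"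
  let ?C = "\<lambda>F. {\<sigma> \<in> lifts m. F \<subseteq> lift_edges m \<sigma>}"
  have finS: "finite ?SS" by (rule finite_subset[of _ "Pow {..<6 * m}"]) auto
  have finF: "finite (?FF S)" for S
    by (rule finite_subset[of _ "Pow (lift_sides m)"]) (auto simp: lift_sides_def)
  have finC: "finite (?C F)" for F using finite_lifts by simp
  have "{\<sigma> \<in> lifts m. \<exists>S\<subseteq>{..<6 * m}. card S = s \<and> s + s div L < card (lift_edges m \<sigma> \<inter> S \<times> S)}
    \<subseteq> (\<Union>S\<in>?SS. \<Union>F\<in>?FF S. ?C F)"
  proof
    fix \<sigma> assume "\<sigma> \<in> {\<sigma> \<in> lifts m. \<exists>S\<subseteq>{..<6 * m}. card S = s \<and> s + s div L < card (lift_edges m \<sigma> \<inter> S \<times> S)}"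
    then obtain S where \<sigma>: "\<sigma> \<in> lifts m" and S: "S \<subseteq> {..<6 * m}" "card S = s"
      "k \<le> card (lift_edges m \<sigma> \<inter> S \<times> S)" unfolding k_def by auto
    obtain F where F: "F \<subseteq> lift_edges m \<sigma> \<inter> S \<times> S" "card F = k"
      using obtain_subset_with_card_n[OF S(3)] by blast
    have "lift_edges m \<sigma> \<subseteq> lift_sides m" by (auto simp: lift_edges_def)
    then have "F \<in> ?FF S" "\<sigma> \<in> ?C F" using F \<sigma> by blast+
    then show "\<sigma> \<in> (\<Union>S\<in>?SS. \<Union>F\<in>?FF S. ?C F)" using S by blast
  qed
  then have "card {\<sigma> \<in> lifts m. \<exists>S\<subseteq>{..<6 * m}. card S = s \<and> s + s div L < card (lift_edges m \<sigma> \<inter> S \<times> S)}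
    \<le> card (\<Union>S\<in>?SS. \<Union>F\<in>?FF S. ?C F)"
    by (rule card_mono[rotated]) (intro finite_UN_I finS finF finC)
  also have "\<dots> \<le> (\<Sum>S\<in>?SS. card (\<Union>F\<in>?FF S. ?C F))" by (rule card_UN_le[OF finS])
  also have "\<dots> \<le> (\<Sum>S\<in>?SS. \<Sum>F\<in>?FF S. card (?C F))" by (intro sum_mono card_UN_le finF)
  finally have "real (card {\<sigma> \<in> lifts m. \<exists>S\<subseteq>{..<6 * m}. card S = s \<and>
      s + s div L < card (lift_edges m \<sigma> \<inter> S \<times> S)}) \<le> (\<Sum>S\<in>?SS. \<Sum>F\<in>?FF S. real (card (?C F)))"
    by (simp flip: of_nat_sum)
  also have "\<dots> \<le> (\<Sum>S\<in>?SS. \<Sum>F\<in>?FF S. fact m ^ 9 * (2 / real m) ^ k)"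
    using km m by (intro sum_mono) (use card_lifts_containing in fastforce)
  also have "\<dots> = (\<Sum>S\<in>?SS. real (card (?FF S)) * (fact m ^ 9 * (2 / real m) ^ k))" by simp
  also have "\<dots> \<le> (\<Sum>S\<in>?SS. real (s ^ 2 choose k) * (fact m ^ 9 * (2 / real m) ^ k))"
  proof (intro sum_mono mult_right_mono of_nat_mono)
    fix S assume S: "S \<in> ?SS"
    then have finS: "finite S" using finite_subset by blast
    have "card (?FF S) \<le> card {F. F \<subseteq> S \<times> S \<and> card F = k}"
      by (rule card_mono) (use finS in auto)
    also have "\<dots> = s ^ 2 choose k"
      using n_subsets[of "S \<times> S" k] finS S by (simp add: card_cartesian_product power2_eq_square)
    finally show "card (?FF S) \<le> s ^ 2 choose k" .
  qed simp
  also have "\<dots> = real (6 * m choose s) * real (s ^ 2 choose k) * (2 / real m) ^ k * fact m ^ 9"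
    using n_subsets[of "{..<6 * m}" s] by simp
  also have "\<dots> \<le> (1 / 4) ^ s * fact m ^ 9"
    by (intro mult_right_mono first_moment_term[OF s m k small]) simp
  finally show ?thesis by (simp only: mult.commute)
qed

text \<open>Summed over all sizes, the fractions of bad lifts stay below 1/4 + 1/16 + ... = 1/3, so
  some lift is good for all sizes at once.\<close>

lemma ex_sparse_lift:
  assumes m: "m \<ge> 1" and L: "L \<ge> 1"
  obtains \<sigma> where "\<sigma> \<in> lifts m"
    "\<And>S. S \<subseteq> {..<6 * m} \<Longrightarrow> 6 * real (card S) / real m \<le> (1 / 432) ^ L \<Longrightarrow>
      card (lift_edges m \<sigma> \<inter> S \<times> S) \<le> card S + card S div L"
proof -
  let ?bad = "\<lambda>s. {\<sigma> \<in> lifts m. \<exists>S\<subseteq>{..<6 * m}. card S = s \<and> s + s div L < card (lift_edges m \<sigma> \<inter> S \<times> S)}"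
  let ?I = "{s \<in> {1..6 * m}. 6 * real s / real m \<le> (1 / 432) ^ L}"
  have "real (card (\<Union>s\<in>?I. ?bad s)) \<le> real (\<Sum>s\<in>?I. card (?bad s))"
    by (intro of_nat_mono card_UN_le) simp
  also have "\<dots> = (\<Sum>s\<in>?I. real (card (?bad s)))" by simp
  also have "\<dots> \<le> (\<Sum>s\<in>?I. fact m ^ 9 * (1 / 4) ^ s)"
    using card_lifts_dense_set[OF _ m L] by (intro sum_mono) auto
  also have "\<dots> \<le> (\<Sum>s\<in>{1..6 * m}. fact m ^ 9 * (1 / 4) ^ s)"
    by (rule sum_mono2) auto
  also have "\<dots> = fact m ^ 9 * (\<Sum>s\<in>{1..6 * m}. (1 / 4) ^ s)" by (simp add: sum_distrib_left)
  also have "(\<Sum>s\<in>{1..n}. (1 / 4 :: real) ^ s) < 1" for n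
  proof -
    have "(\<Sum>s\<in>{1..n}. (1 / 4 :: real) ^ s) = (1 - (1 / 4) ^ n) / 3"
    proof (induction n)
      case (Suc n)
      have eq: "(1 - x) / 3 + 1 / 4 * x = (1 - 1 / 4 * x) / 3" for x :: real
        by (simp add: field_simps)
      have "(\<Sum>s\<in>{1..Suc n}. (1 / 4 :: real) ^ s) = (\<Sum>s\<in>{1..n}. (1 / 4) ^ s) + (1 / 4) ^ Suc n" by simp
      also have "\<dots> = (1 - (1 / 4) ^ Suc n) / 3" unfolding Suc.IH power_Suc by (rule eq)
      finally show ?case .
    qed simp
    also have "(1 - x) / 3 < 1" if "x > 0" for x :: real using that by simp
    finally show ?thesis by simp
  qed
  finally have "real (card (\<Union>s\<in>?I. ?bad s)) < real (card (lifts m))"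
    by (simp add: card_lifts)
  then have "card (\<Union>s\<in>?I. ?bad s) < card (lifts m)" by simp
  moreover have "finite (\<Union>s\<in>?I. ?bad s)" using finite_lifts by (intro finite_UN_I) auto
  ultimately have "\<not> lifts m \<subseteq> (\<Union>s\<in>?I. ?bad s)"
    using card_mono[of "\<Union>s\<in>?I. ?bad s" "lifts m"] by linarith
  then obtain \<sigma> where \<sigma>: "\<sigma> \<in> lifts m" "\<sigma> \<notin> (\<Union>s\<in>?I. ?bad s)" by blast
  show ?thesis
  proof (rule that[OF \<sigma>(1)])
    fix S assume S: "S \<subseteq> {..<6 * m}" "6 * real (card S) / real m \<le> (1 / 432) ^ L"
    have fin: "finite S" using S finite_subset by blast
    show "card (lift_edges m \<sigma> \<inter> S \<times> S) \<le> card S + card S div L"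
    proof (cases "S = {}")
      case False
      then have "1 \<le> card S" using fin by (simp add: Suc_le_eq card_gt_0_iff)
      moreover have "card S \<le> 6 * m" using card_mono[OF finite_lessThan S(1)] by simp
      ultimately have "card S \<in> ?I" using S(2) by simp
      then have "\<sigma> \<notin> ?bad (card S)" using \<sigma>(2) by blast
      then have "\<not> card S + card S div L < card (lift_edges m \<sigma> \<inter> S \<times> S)" using \<sigma>(1) S(1) by simp
      then show ?thesis by simp
    qed simp
  qed
qed

theorem ex_sparse_cubic_graph:
  assumes m: "m \<ge> 1" and L: "L \<ge> 1"
  obtains G :: "nat pair_pre_digraph" where "regular_graph 3 (with_proj G)" "card (pverts G) = 6 * m"
    "\<And>u v w. (u, v) \<in> parcs G \<Longrightarrow> (v, w) \<in> parcs G \<Longrightarrow> (u, w) \<notin> parcs G"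
    "\<And>S. S \<subseteq> pverts G \<Longrightarrow> real (card S) \<le> (1 / 432) ^ L / 6 * real m \<Longrightarrow> sparse_arcs (parcs G) L S"
proof -
  obtain \<sigma> where \<sigma>: "\<sigma> \<in> lifts m" and sp: "\<And>S. S \<subseteq> {..<6 * m} \<Longrightarrow>
      6 * real (card S) / real m \<le> (1 / 432) ^ L \<Longrightarrow>
      card (lift_edges m \<sigma> \<inter> S \<times> S) \<le> card S + card S div L"
    using ex_sparse_lift[OF m L] by blast
  let ?G = "lift_graph m \<sigma>" and ?E = "lift_edges m \<sigma>"
  \<comment> \<open>Arcs change sides, so the graph is bipartite; this excludes triangles.\<close>
  have side: "u mod 6 < 3 \<longleftrightarrow> \<not> v mod 6 < 3" if "(u, v) \<in> parcs ?G" for u v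
    using that by (auto simp: lift_graph_def lift_edges_def lift_sides_def)
  show ?thesis
  proof (rule that[of ?G])
    show "regular_graph 3 (with_proj ?G)" by (rule lift_graph_regular[OF \<sigma>])
    show "card (pverts ?G) = 6 * m" by (simp add: lift_graph_def)
    show "(u, w) \<notin> parcs ?G" if "(u, v) \<in> parcs ?G" "(v, w) \<in> parcs ?G" for u v w
      using side[OF that(1)] side[OF that(2)] side[of u w] by blast
    show "sparse_arcs (parcs ?G) L S"
      if S: "S \<subseteq> pverts ?G" "real (card S) \<le> (1 / 432) ^ L / 6 * real m" for S
    proof -
      have finE: "finite (?E \<inter> S \<times> S)"
        by (rule finite_subset[of _ "lift_sides m"]) (auto simp: lift_edges_def lift_sides_def)
      have "inner_arcs (parcs ?G) S \<le> card ((?E \<inter> S \<times> S) \<union> prod.swap ` (?E \<inter> S \<times> S))"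
        unfolding inner_arcs_def lift_graph_def by (rule card_mono) (use finE in force)+
      also have "\<dots> \<le> card (?E \<inter> S \<times> S) + card (prod.swap ` (?E \<inter> S \<times> S))" by (rule card_Un_le)
      also have "\<dots> \<le> 2 * card (?E \<inter> S \<times> S)" using card_image_le[OF finE, of prod.swap] by simp
      also have "\<dots> \<le> 2 * (card S + card S div L)"
        using sp[of S] S m by (simp add: lift_graph_def field_simps)
      finally have "L * inner_arcs (parcs ?G) S \<le> L * (2 * (card S + card S div L))"
        by (rule mult_le_mono2)
      also have "\<dots> = 2 * L * card S + 2 * (L * (card S div L))" by (simp add: algebra_simps)
      also have "\<dots> \<le> 2 * L * card S + 2 * card S" by (simp add: times_div_less_eq_dividend)
      finally show ?thesis unfolding sparse_arcs_def by (simp add: algebra_simps)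
    qed
  qed
qed

section \<open>Random orderings\<close>

text \<open>Replaces positions by subsequences, which behave well under filtering and
  concatenation.\<close>

lemma precedes_iff_subseq: "precedes \<pi> u v \<longleftrightarrow> subseq [u, v] \<pi>"
proof
  assume "precedes \<pi> u v"
  then obtain i j where ij: "i < j" "j < length \<pi>" "\<pi> ! i = u" "\<pi> ! j = v"
    by (auto simp: precedes_def)
  have "subseq [u] (take j \<pi>)"
    using ij by (auto simp: subseq_singleton_left in_set_conv_nth intro!: exI[of _ i])
  moreover have "subseq [v] (drop j \<pi>)"
    using ij by (auto simp: subseq_singleton_left in_set_conv_nth intro!: exI[of _ 0])
  ultimately have "subseq ([u] @ [v]) (take j \<pi> @ drop j \<pi>)" by (rule list_emb_append_mono)
  then show "subseq [u, v] \<pi>" by simp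
next
  assume "subseq [u, v] \<pi>"
  then obtain us vs where us: "\<pi> = us @ u # vs" "subseq [v] vs"
    using list_emb_ConsD[of "(=)" u "[v]" \<pi>] by auto
  then obtain j where "j < length vs" "vs ! j = v"
    by (auto simp: subseq_singleton_left in_set_conv_nth)
  then show "precedes \<pi> u v"
    unfolding precedes_def us
    by (intro exI[of _ "length us"] exI[of _ "length us + 1 + j"]) (auto simp: nth_append)
qed

lemma precedes_filter:
  assumes "Q u" "Q v"
  shows "precedes (filter Q \<pi>) u v \<longleftrightarrow> precedes \<pi> u v"
  unfolding precedes_iff_subseq
proof
  assume "subseq [u, v] (filter Q \<pi>)"
  then show "subseq [u, v] \<pi>" using subseq_filter_left subseq_order.order_trans by blast
next
  assume "subseq [u, v] \<pi>"
  from subseq_filter[OF this, of Q] show "subseq [u, v] (filter Q \<pi>)" using assms by simp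
qed

lemma precedes_appendI: "u \<in> set xs \<Longrightarrow> v \<in> set ys \<Longrightarrow> precedes (xs @ ys) u v"
  using list_emb_append_mono[of "(=)" "[u]" xs "[v]" ys]
  by (simp add: precedes_iff_subseq subseq_singleton_left)

lemma precedes_map: "inj f \<Longrightarrow> precedes (map f \<pi>) (f u) (f v) \<longleftrightarrow> precedes \<pi> u v"
proof -
  assume "inj f"
  then have "i < j \<and> j < length (map f \<pi>) \<and> map f \<pi> ! i = f u \<and> map f \<pi> ! j = f v \<longleftrightarrow>
    i < j \<and> j < length \<pi> \<and> \<pi> ! i = u \<and> \<pi> ! j = v" for i j
    by (auto simp: inj_eq)
  then show ?thesis unfolding precedes_def by (simp only:)
qed

lemma precedes_antisym:
  assumes "distinct \<pi>" "precedes \<pi> u v"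
  shows "\<not> precedes \<pi> v u"
  using assms unfolding precedes_def
  by (metis (no_types, lifting) distinct_conv_nth less_trans nat_neq_iff)

section \<open>Relabelling and restricting orderings\<close>

lemma bij_betw_map_permutations_of_set:
  assumes "\<sigma> permutes A"
  shows "bij_betw (map \<sigma>) (permutations_of_set A) (permutations_of_set A)"
  unfolding bij_betw_def
  using permutations_of_set_image_permutes[OF assms] permutes_inj[OF assms]
  by (auto intro: inj_on_subset inj_mapI)

lemma filter_permutations_of_set:
  assumes "\<pi> \<in> permutations_of_set V" "A \<subseteq> V"
  shows "filter (\<lambda>x. x \<in> A) \<pi> \<in> permutations_of_set A"
  using assms by (auto simp: permutations_of_set_def)

lemma filter_map_permutes:
  assumes "\<sigma> permutes A"
  shows "filter (\<lambda>x. x \<in> A) (map \<sigma> \<pi>) = map \<sigma> (filter (\<lambda>x. x \<in> A) \<pi>)"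
  using permutes_in_image[OF assms] by (induction \<pi>) auto

lemma filter_map_permutes_disjoint:
  assumes "\<sigma> permutes A" "A \<inter> B = {}"
  shows "filter (\<lambda>x. x \<in> B) (map \<sigma> \<pi>) = filter (\<lambda>x. x \<in> B) \<pi>"
proof (induction \<pi>)
  case (Cons a \<pi>)
  show ?case
  proof (cases "a \<in> A")
    case True
    then have "\<sigma> a \<in> A" using permutes_in_image[OF assms(1)] by simp
    with True show ?thesis using Cons assms(2) by auto
  next
    case False
    then show ?thesis using Cons permutes_not_in[OF assms(1)] by auto
  qed
qed simp

lemma bij_betw_map_permuting:
  assumes "\<alpha> \<in> permutations_of_set A"
  shows "bij_betw (\<lambda>\<sigma>. map \<sigma> \<alpha>) {\<sigma>. \<sigma> permutes A} (permutations_of_set A)"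
proof -
  have \<alpha>: "set \<alpha> = A" "distinct \<alpha>" using assms by (auto dest: permutations_of_setD)
  have fin: "finite A" using \<alpha> by auto
  have inj: "inj_on (\<lambda>\<sigma>. map \<sigma> \<alpha>) {\<sigma>. \<sigma> permutes A}"
  proof (rule inj_onI)
    fix \<sigma> \<tau> assume *: "\<sigma> \<in> {\<sigma>. \<sigma> permutes A}" "\<tau> \<in> {\<sigma>. \<sigma> permutes A}" "map \<sigma> \<alpha> = map \<tau> \<alpha>"
    show "\<sigma> = \<tau>"
    proof
      fix x show "\<sigma> x = \<tau> x"
        using * \<alpha> by (cases "x \<in> A") (auto simp: permutes_not_in)
    qed
  qed
  have sub: "(\<lambda>\<sigma>. map \<sigma> \<alpha>) ` {\<sigma>. \<sigma> permutes A} \<subseteq> permutations_of_set A"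
    using permutations_of_set_image_permutes assms by blast
  have "card ((\<lambda>\<sigma>. map \<sigma> \<alpha>) ` {\<sigma>. \<sigma> permutes A}) = card (permutations_of_set A)"
    using card_image[OF inj] card_permutations[OF refl fin] fin by simp
  then show ?thesis
    using card_subset_eq[OF finite_permutations_of_set sub] inj by (simp add: bij_betw_def)
qed

text \<open>
  Averaging over the permutations of \<open>A\<close>, which act on the orderings of \<open>V\<close> without changing
  their restriction to \<open>B\<close>.
\<close>

lemma sum_permutations_of_set_independent_aux:
  fixes f g :: "'a list \<Rightarrow> real"
  assumes V: "finite V" and AB: "A \<subseteq> V" "B \<subseteq> V" "A \<inter> B = {}"
  shows "fact (card A) * (\<Sum>\<pi>\<in>permutations_of_set V.
      f (filter (\<lambda>x. x \<in> A) \<pi>) * g (filter (\<lambda>x. x \<in> B) \<pi>)) =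
    (\<Sum>\<alpha>\<in>permutations_of_set A. f \<alpha>) * (\<Sum>\<pi>\<in>permutations_of_set V. g (filter (\<lambda>x. x \<in> B) \<pi>))"
proof -
  let ?V = "permutations_of_set V" and ?S = "{\<sigma>. \<sigma> permutes A}"
  let ?A = "filter (\<lambda>x. x \<in> A)" and ?B = "filter (\<lambda>x. x \<in> B)"
  have finA: "finite A" using V AB finite_subset by blast
  have "(\<Sum>\<pi>\<in>?V. f (?A \<pi>) * g (?B \<pi>)) = (\<Sum>\<pi>\<in>?V. f (map \<sigma> (?A \<pi>)) * g (?B \<pi>))"
    if \<sigma>: "\<sigma> permutes A" for \<sigma>
  proof -
    have "(\<Sum>\<pi>\<in>?V. f (?A (map \<sigma> \<pi>)) * g (?B (map \<sigma> \<pi>))) = (\<Sum>\<pi>\<in>?V. f (?A \<pi>) * g (?B \<pi>))"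
      by (rule sum.reindex_bij_betw[OF bij_betw_map_permutations_of_set])
        (rule permutes_subset[OF \<sigma> AB(1)])
    then show ?thesis
      using \<sigma> AB(3) by (simp add: filter_map_permutes filter_map_permutes_disjoint del: filter_map)
  qed
  then have "(\<Sum>\<sigma>\<in>?S. \<Sum>\<pi>\<in>?V. f (?A \<pi>) * g (?B \<pi>)) =
      (\<Sum>\<sigma>\<in>?S. \<Sum>\<pi>\<in>?V. f (map \<sigma> (?A \<pi>)) * g (?B \<pi>))"
    by (rule sum.cong[OF refl]) blast
  also have "\<dots> = (\<Sum>\<pi>\<in>?V. \<Sum>\<sigma>\<in>?S. f (map \<sigma> (?A \<pi>)) * g (?B \<pi>))"
    by (rule sum.swap)
  also have "\<dots> = (\<Sum>\<pi>\<in>?V. (\<Sum>\<alpha>\<in>permutations_of_set A. f \<alpha>) * g (?B \<pi>))"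
  proof (rule sum.cong)
    fix \<pi> assume "\<pi> \<in> ?V"
    then have "?A \<pi> \<in> permutations_of_set A" using AB filter_permutations_of_set by blast
    from sum.reindex_bij_betw[OF bij_betw_map_permuting[OF this], of f]
    show "(\<Sum>\<sigma>\<in>?S. f (map \<sigma> (?A \<pi>)) * g (?B \<pi>)) = (\<Sum>\<alpha>\<in>permutations_of_set A. f \<alpha>) * g (?B \<pi>)"
      by (simp add: sum_distrib_right[symmetric])
  qed simp
  also have "\<dots> = (\<Sum>\<alpha>\<in>permutations_of_set A. f \<alpha>) * (\<Sum>\<pi>\<in>?V. g (?B \<pi>))"
    by (simp add: sum_distrib_left)
  finally show ?thesis using card_permutations[OF refl finA] by simp
qed

text \<open>Relative orders on disjoint sets are independent. The auxiliary identity is used twice,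
  once with \<open>g = 1\<close> to express the sum over orderings of \<open>A\<close> by one over
  orderings of \<open>V\<close>.\<close>

lemma sum_permutations_of_set_independent:
  fixes f g :: "'a list \<Rightarrow> real"
  assumes V: "finite V" and AB: "A \<subseteq> V" "B \<subseteq> V" "A \<inter> B = {}"
  shows "fact (card V) * (\<Sum>\<pi>\<in>permutations_of_set V.
      f (filter (\<lambda>x. x \<in> A) \<pi>) * g (filter (\<lambda>x. x \<in> B) \<pi>)) =
    (\<Sum>\<pi>\<in>permutations_of_set V. f (filter (\<lambda>x. x \<in> A) \<pi>)) *
    (\<Sum>\<pi>\<in>permutations_of_set V. g (filter (\<lambda>x. x \<in> B) \<pi>))"
proof -
  let ?V = "permutations_of_set V"
  let ?A = "filter (\<lambda>x. x \<in> A)" and ?B = "filter (\<lambda>x. x \<in> B)"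
  have "fact (card A) * (fact (card V) * (\<Sum>\<pi>\<in>?V. f (?A \<pi>) * g (?B \<pi>))) =
    fact (card V) * (\<Sum>\<alpha>\<in>permutations_of_set A. f \<alpha>) * (\<Sum>\<pi>\<in>?V. g (?B \<pi>))"
    using sum_permutations_of_set_independent_aux[OF assms, of f g] by (simp add: algebra_simps)
  also have "fact (card V) * (\<Sum>\<alpha>\<in>permutations_of_set A. f \<alpha>) = fact (card A) * (\<Sum>\<pi>\<in>?V. f (?A \<pi>))"
    using sum_permutations_of_set_independent_aux[OF assms, of f "\<lambda>_. 1"] V by (simp add: mult.commute)
  finally show ?thesis by simp
qed

lemma ex_permutes_image_eq:
  assumes "finite Z" "U \<subseteq> Z" "U' \<subseteq> Z" "card U = card U'"
  obtains \<sigma> where "\<sigma> permutes Z" "\<sigma> ` U = U'"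
proof -
  have fin: "finite U" "finite U'" using assms finite_subset by auto
  obtain f where f: "bij_betw f U U'" using fin assms(4) finite_same_card_bij by blast
  have "card (Z - U) = card (Z - U')" using assms fin by (simp add: card_Diff_subset)
  then obtain g where g: "bij_betw g (Z - U) (Z - U')"
    using assms(1) finite_same_card_bij[of "Z - U" "Z - U'"] by blast
  let ?h = "\<lambda>x. if x \<in> U then f x else if x \<in> Z then g x else x"
  have hU: "bij_betw ?h U U'" using f by (rule bij_betw_cong[THEN iffD1, rotated]) auto
  have "bij_betw ?h (Z - U) (Z - U')" using g by (rule bij_betw_cong[THEN iffD1, rotated]) auto
  then have "bij_betw ?h (U \<union> (Z - U)) (U' \<union> (Z - U'))"
    by (intro bij_betw_combine[OF hU]) auto
  then have "bij_betw ?h Z Z" using assms(2,3) by (simp add: Un_absorb1)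
  then have "?h permutes Z" using assms(2) by (intro bij_imp_permutes) auto
  moreover have "?h ` U = U'" using hU by (simp add: bij_betw_def)
  ultimately show ?thesis using that by blast
qed

text \<open>By symmetry, the set of the last \<open>card U\<close> elements of \<open>Z\<close> is
  uniformly distributed over the subsets of \<open>Z\<close> of that size: the events for these
  subsets partition the orderings, and permutations of \<open>Z\<close> map them to each
  other.\<close>

lemma card_orderings_ending_in:
  assumes V: "finite V" and Z: "Z \<subseteq> V" and U: "U \<subseteq> Z"
  shows "card {\<pi> \<in> permutations_of_set V. \<forall>z\<in>Z - U. \<forall>u\<in>U. precedes \<pi> z u} * (card Z choose card U)
    = fact (card V)"
proof -
  define Ev where "Ev U = {\<pi> \<in> permutations_of_set V. \<forall>z\<in>Z - U. \<forall>u\<in>U. precedes \<pi> z u}" for U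
  define k where "k = card U"
  let ?F = "{U'. U' \<subseteq> Z \<and> card U' = k}"
  have finZ: "finite Z" using V Z finite_subset by blast
  have finEv: "finite (Ev U')" for U' unfolding Ev_def by simp
  have le: "card (Ev A) \<le> card (Ev B)" if AB: "A \<in> ?F" "B \<in> ?F" for A B
  proof -
    obtain \<sigma> where \<sigma>: "\<sigma> permutes Z" "\<sigma> ` A = B"
      using ex_permutes_image_eq[OF finZ, of A B] AB by auto
    have inj: "inj \<sigma>" using \<sigma> permutes_inj by blast
    have ZB: "\<sigma> ` (Z - A) = Z - B"
      using image_set_diff[OF inj, of Z A] permutes_image[OF \<sigma>(1)] \<sigma>(2) by simp
    have "map \<sigma> ` Ev A \<subseteq> Ev B"
    proof
      fix \<rho> assume "\<rho> \<in> map \<sigma> ` Ev A"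
      then obtain \<pi> where \<pi>: "\<pi> \<in> Ev A" "\<rho> = map \<sigma> \<pi>" by blast
      have "\<rho> \<in> permutations_of_set V"
        using permutations_of_set_image_permutes[OF permutes_subset[OF \<sigma>(1) Z]] \<pi> unfolding Ev_def by auto
      moreover have "precedes \<rho> z u" if zu: "z \<in> Z - B" "u \<in> B" for z u
      proof -
        obtain z' u' where "z' \<in> Z - A" "u' \<in> A" "z = \<sigma> z'" "u = \<sigma> u'"
          using zu ZB \<sigma>(2) by blast
        then show ?thesis using \<pi> precedes_map[OF inj] unfolding Ev_def by simp
      qed
      ultimately show "\<rho> \<in> Ev B" unfolding Ev_def by auto
    qed
    moreover have "inj_on (map \<sigma>) (Ev A)" using inj by (auto intro: inj_on_subset inj_mapI)
    ultimately show ?thesis using finEv card_inj_on_le by blast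
  qed
  have UF: "U \<in> ?F" using U k_def by simp
  have eq: "card (Ev A) = card (Ev U)" if "A \<in> ?F" for A
    using le[OF that UF] le[OF UF that] by simp
  have cover: "permutations_of_set V = (\<Union>A\<in>?F. Ev A)"
  proof
    show "permutations_of_set V \<subseteq> (\<Union>A\<in>?F. Ev A)"
    proof
      fix \<pi> assume \<pi>: "\<pi> \<in> permutations_of_set V"
      define xs where "xs = filter (\<lambda>x. x \<in> Z) \<pi>"
      have xs: "set xs = Z" "distinct xs"
        using permutations_of_setD[OF filter_permutations_of_set[OF \<pi> Z]] unfolding xs_def by blast+
      let ?i = "length xs - k"
      have len: "length xs = card Z" using xs distinct_card by fastforce
      have "k \<le> length xs" using card_mono[OF finZ U] len k_def by simp
      then have "card (set (drop ?i xs)) = k" using xs by (simp add: distinct_card)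
      moreover have "set (drop ?i xs) \<subseteq> Z" using xs set_drop_subset by fastforce
      moreover have "Z - set (drop ?i xs) \<subseteq> set (take ?i xs)"
        using xs set_append[of "take ?i xs" "drop ?i xs"] by auto
      moreover have "precedes \<pi> z u" if "z \<in> set (take ?i xs)" "u \<in> set (drop ?i xs)" for z u
      proof -
        have "z \<in> Z" "u \<in> Z" using that xs by (auto dest: in_set_takeD in_set_dropD)
        then show ?thesis
          using precedes_appendI[OF that] precedes_filter[of "\<lambda>x. x \<in> Z" z u \<pi>] unfolding xs_def by simp
      qed
      ultimately have "set (drop ?i xs) \<in> ?F" "\<pi> \<in> Ev (set (drop ?i xs))"
        unfolding Ev_def using \<pi> by blast+
      then show "\<pi> \<in> (\<Union>A\<in>?F. Ev A)" by blast
    qed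
  qed (auto simp: Ev_def)
  have disj: "Ev A \<inter> Ev B = {}" if "A \<in> ?F" "B \<in> ?F" "A \<noteq> B" for A B
  proof (rule ccontr)
    assume "Ev A \<inter> Ev B \<noteq> {}"
    then obtain \<pi> where \<pi>: "\<pi> \<in> Ev A" "\<pi> \<in> Ev B" by blast
    have fin: "finite A" "finite B" using that finZ finite_subset by auto
    have "\<not> A \<subseteq> B" "\<not> B \<subseteq> A"
      using that card_subset_eq[OF fin(2), of A] card_subset_eq[OF fin(1), of B] by auto
    then obtain a b where "a \<in> A" "a \<notin> B" "b \<in> B" "b \<notin> A" by blast
    then have "precedes \<pi> a b" "precedes \<pi> b a" "distinct \<pi>"
      using \<pi> that unfolding Ev_def by (auto dest: permutations_of_setD)
    then show False using precedes_antisym by fast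
  qed
  have "fact (card V) = card (permutations_of_set V)" using V by simp
  also have "\<dots> = (\<Sum>A\<in>?F. card (Ev A))"
    unfolding cover by (rule card_UN_disjoint) (use finZ finEv disj in auto)
  also have "\<dots> = card ?F * card (Ev U)" using eq by simp
  finally show ?thesis using n_subsets[OF finZ, of k] unfolding Ev_def k_def by (simp add: mult.commute)
qed

text \<open>
  Chebyshev's inequality, multiplied out: only pairs with overlapping neighbourhoods contribute to
  the second moment.
\<close>

lemma orderings_second_moment:
  fixes h :: "'a \<Rightarrow> 'a list \<Rightarrow> real" and Z :: "'a \<Rightarrow> 'a set"
  defines "Y \<equiv> \<lambda>v \<pi>. h v (filter (\<lambda>x. x \<in> Z v) \<pi>)"
  assumes V: "finite V" and Z: "\<And>v. v \<in> V \<Longrightarrow> Z v \<subseteq> V"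
    and bound: "\<And>v xs. v \<in> V \<Longrightarrow> \<bar>h v xs\<bar> \<le> C"
    and mean: "\<And>v. v \<in> V \<Longrightarrow> \<mu> * fact (card V) \<le> (\<Sum>\<pi>\<in>permutations_of_set V. Y v \<pi>)"
    and \<mu>: "\<mu> \<ge> 0"
    and overlap: "\<And>v. v \<in> V \<Longrightarrow> card {w \<in> V. Z v \<inter> Z w \<noteq> {}} \<le> \<Delta>"
  shows "real (card {\<pi> \<in> permutations_of_set V. (\<Sum>v\<in>V. Y v \<pi>) \<le> \<mu> / 2 * card V}) * (\<mu> / 2 * card V)\<^sup>2
    \<le> real (card V) * real \<Delta> * (2 * C)\<^sup>2 * fact (card V)"
proof -
  let ?P = "permutations_of_set V"
  define n :: real where "n = fact (card V)"
  have n: "n > 0" "real (card ?P) = n" using V by (simp_all add: n_def)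
  define e where "e v = (\<Sum>\<pi>\<in>?P. Y v \<pi>) / n" for v
  define z where "z v \<pi> = Y v \<pi> - e v" for v \<pi>
  have ze: "(\<Sum>\<pi>\<in>?P. z v \<pi>) = 0" for v
    using n by (simp add: z_def e_def sum_subtractf)
  have e: "\<bar>e v\<bar> \<le> C" if "v \<in> V" for v
  proof -
    have "\<bar>\<Sum>\<pi>\<in>?P. Y v \<pi>\<bar> \<le> (\<Sum>\<pi>\<in>?P. \<bar>Y v \<pi>\<bar>)" by (rule sum_abs)
    also have "\<dots> \<le> real (card ?P) * C"
      by (rule sum_bounded_above) (use bound that in \<open>auto simp: Y_def\<close>)
    finally show ?thesis using n by (simp add: e_def field_simps)
  qed
  have zb: "\<bar>z v \<pi>\<bar> \<le> 2 * C" if "v \<in> V" for v \<pi>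
    using e[OF that] bound[OF that, of "filter (\<lambda>x. x \<in> Z v) \<pi>"] unfolding z_def Y_def by linarith
  have pair: "(\<Sum>\<pi>\<in>?P. z v \<pi> * z w \<pi>) \<le> (if Z v \<inter> Z w \<noteq> {} then n * (2 * C)\<^sup>2 else 0)"
    if vw: "v \<in> V" "w \<in> V" for v w
  proof (cases "Z v \<inter> Z w = {}")
    case True
    have "n * (\<Sum>\<pi>\<in>?P. z v \<pi> * z w \<pi>) = (\<Sum>\<pi>\<in>?P. z v \<pi>) * (\<Sum>\<pi>\<in>?P. z w \<pi>)"
      using sum_permutations_of_set_independent[OF V Z[OF vw(1)] Z[OF vw(2)] True,
        of "\<lambda>xs. h v xs - e v" "\<lambda>xs. h w xs - e w"]
      by (simp add: z_def Y_def n_def)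
    then show ?thesis using True n ze by simp
  next
    case False
    have "z v \<pi> * z w \<pi> \<le> (2 * C)\<^sup>2" for \<pi>
    proof -
      have "z v \<pi> * z w \<pi> \<le> \<bar>z v \<pi>\<bar> * \<bar>z w \<pi>\<bar>" by (metis abs_ge_self abs_mult)
      also have "\<dots> \<le> (2 * C) * (2 * C)"
        by (intro mult_mono zb vw) (use zb[OF vw(1), of \<pi>] in auto)
      finally show ?thesis by (simp add: power2_eq_square)
    qed
    then have "(\<Sum>\<pi>\<in>?P. z v \<pi> * z w \<pi>) \<le> real (card ?P) * (2 * C)\<^sup>2"
      by (intro sum_bounded_above) auto
    then show ?thesis using False n by simp
  qed
  have "(\<Sum>\<pi>\<in>?P. (\<Sum>v\<in>V. z v \<pi>)\<^sup>2) = (\<Sum>\<pi>\<in>?P. \<Sum>v\<in>V. \<Sum>w\<in>V. z v \<pi> * z w \<pi>)"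
    by (simp add: power2_eq_square sum_product)
  also have "\<dots> = (\<Sum>v\<in>V. \<Sum>\<pi>\<in>?P. \<Sum>w\<in>V. z v \<pi> * z w \<pi>)" by (rule sum.swap)
  also have "\<dots> = (\<Sum>v\<in>V. \<Sum>w\<in>V. \<Sum>\<pi>\<in>?P. z v \<pi> * z w \<pi>)"
    by (intro sum.cong refl sum.swap)
  also have "\<dots> \<le> (\<Sum>v\<in>V. \<Sum>w\<in>V. if Z v \<inter> Z w \<noteq> {} then n * (2 * C)\<^sup>2 else 0)"
    by (intro sum_mono pair)
  also have "\<dots> = (\<Sum>v\<in>V. real (card {w \<in> V. Z v \<inter> Z w \<noteq> {}}) * (n * (2 * C)\<^sup>2))"
    using V by (simp add: sum.If_cases Int_def)
  also have "\<dots> \<le> (\<Sum>v\<in>V. real \<Delta> * (n * (2 * C)\<^sup>2))"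
    using n by (intro sum_mono mult_right_mono) (auto simp: overlap)
  also have "\<dots> = real (card V) * real \<Delta> * (2 * C)\<^sup>2 * n" by simp
  finally have up: "(\<Sum>\<pi>\<in>?P. (\<Sum>v\<in>V. z v \<pi>)\<^sup>2) \<le> real (card V) * real \<Delta> * (2 * C)\<^sup>2 * n" .
  let ?bad = "{\<pi> \<in> ?P. (\<Sum>v\<in>V. Y v \<pi>) \<le> \<mu> / 2 * card V}"
  \<comment> \<open>The means add up to at least \<open>\<mu> * card V\<close>, so on a bad ordering
    the centred sum is at most \<open>- \<mu> / 2 * card V\<close>.\<close>
  have low: "(\<mu> / 2 * card V)\<^sup>2 \<le> (\<Sum>v\<in>V. z v \<pi>)\<^sup>2" if "\<pi> \<in> ?bad" for \<pi>
  proof -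
    have "real (card V) * \<mu> \<le> (\<Sum>v\<in>V. e v)"
      using sum_bounded_below[of V \<mu> e] mean n by (simp add: e_def n_def field_simps)
    moreover have "(\<Sum>v\<in>V. z v \<pi>) = (\<Sum>v\<in>V. Y v \<pi>) - (\<Sum>v\<in>V. e v)"
      by (simp add: z_def sum_subtractf)
    ultimately have "\<mu> / 2 * card V \<le> - (\<Sum>v\<in>V. z v \<pi>)" using that by (simp add: field_simps)
    then have "(\<mu> / 2 * card V)\<^sup>2 \<le> (- (\<Sum>v\<in>V. z v \<pi>))\<^sup>2"
      by (rule power_mono) (use \<mu> in simp)
    then show ?thesis by simp
  qed
  have "real (card ?bad) * (\<mu> / 2 * card V)\<^sup>2 \<le> (\<Sum>\<pi>\<in>?bad. (\<Sum>v\<in>V. z v \<pi>)\<^sup>2)"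
    by (rule sum_bounded_below) (rule low)
  also have "\<dots> \<le> (\<Sum>\<pi>\<in>?P. (\<Sum>v\<in>V. z v \<pi>)\<^sup>2)"
    by (rule sum_mono2) auto
  also note up
  finally show ?thesis by (simp add: n_def)
qed

section \<open>The core of a cubic graph\<close>

text \<open>Taken with \<open>u = v = w\<close>, triangle-freeness also excludes loops.\<close>

locale triangle_free_cubic =
  fixes V :: "'a set" and P :: "('a \<times> 'a) set"
  assumes finite_V: "finite V" and P_sub: "P \<subseteq> V \<times> V" and sym_P: "sym P"
    and deg: "v \<in> V \<Longrightarrow> card {u. (v, u) \<in> P} = 3"
    and triangle_free: "(u, v) \<in> P \<Longrightarrow> (v, w) \<in> P \<Longrightarrow> (u, w) \<notin> P"
begin

definition nbrs :: "'a \<Rightarrow> 'a set" where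
  "nbrs v = {u. (v, u) \<in> P}"

definition local_maxima :: "'a list \<Rightarrow> 'a set" where
  "local_maxima \<pi> = {v \<in> V. \<forall>u\<in>nbrs v. precedes \<pi> u v}"

text \<open>That such a vertex is itself no local maximum is a consequence, shown in
  \<open>card_core\<close>.\<close>

definition isolated :: "'a list \<Rightarrow> 'a set" where
  "isolated \<pi> = {v \<in> V. nbrs v \<subseteq> local_maxima \<pi>}"

definition core :: "'a list \<Rightarrow> 'a set" where
  "core \<pi> = V - local_maxima \<pi> - isolated \<pi>"

text \<open>The relative order on this set determines \<open>local_excess v\<close>. A vertex of the
  graph belongs to its own ball, as a neighbour of its neighbours.\<close>

definition ball2 :: "'a \<Rightarrow> 'a set" where
  "ball2 v = nbrs v \<union> (\<Union>u\<in>nbrs v. nbrs u)"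

lemma nbrs_sub: "nbrs v \<subseteq> V" using P_sub by (auto simp: nbrs_def)
lemma finite_nbrs: "finite (nbrs v)" using nbrs_sub finite_V finite_subset by blast
lemma card_nbrs: "v \<in> V \<Longrightarrow> card (nbrs v) = 3" by (simp add: nbrs_def deg)
lemma nbrs_sym: "u \<in> nbrs v \<longleftrightarrow> v \<in> nbrs u" using sym_P by (auto simp: nbrs_def elim: symE)
lemma ball2_sub: "ball2 v \<subseteq> V" using nbrs_sub by (auto simp: ball2_def)
lemma finite_ball2: "finite (ball2 v)" using ball2_sub finite_V finite_subset by blast
lemma not_nbr_self: "v \<notin> nbrs v" using triangle_free[of v v v] by (auto simp: nbrs_def)
lemma nbrs_nonempty: "v \<in> V \<Longrightarrow> nbrs v \<noteq> {}" using card_nbrs by force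

text \<open>1 + 3 + 3 * 2: each neighbour of \<open>v\<close> has \<open>v\<close> and two more
  neighbours.\<close>

lemma card_ball2:
  assumes "v \<in> V"
  shows "card (ball2 v) \<le> 10"
proof -
  have two: "card (nbrs u - {v}) = 2" if "u \<in> nbrs v" for u
  proof -
    have "v \<in> nbrs u" "u \<in> V" using that nbrs_sym nbrs_sub by blast+
    then show ?thesis using card_nbrs[of u] by (simp add: card_Diff_singleton)
  qed
  have "card (\<Union>u\<in>nbrs v. nbrs u - {v}) \<le> (\<Sum>u\<in>nbrs v. card (nbrs u - {v}))"
    by (rule card_UN_le[OF finite_nbrs])
  also have "\<dots> = 6" using two card_nbrs[OF assms] by simp
  finally have 6: "card (\<Union>u\<in>nbrs v. nbrs u - {v}) \<le> 6" .
  have fin: "finite (nbrs v \<union> (\<Union>u\<in>nbrs v. nbrs u - {v}))"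
    using finite_nbrs by (intro finite_UnI finite_UN_I) auto
  have "ball2 v \<subseteq> insert v (nbrs v \<union> (\<Union>u\<in>nbrs v. nbrs u - {v}))" by (auto simp: ball2_def)
  then have "card (ball2 v) \<le> card (insert v (nbrs v \<union> (\<Union>u\<in>nbrs v. nbrs u - {v})))"
    by (rule card_mono[OF finite.insertI[OF fin]])
  also have "\<dots> \<le> Suc (card (nbrs v \<union> (\<Union>u\<in>nbrs v. nbrs u - {v})))"
    by (simp only: card_insert_if[OF fin]) simp
  also have "card (nbrs v \<union> (\<Union>u\<in>nbrs v. nbrs u - {v})) \<le> 3 + 6"
    using card_Un_le[of "nbrs v" "\<Union>u\<in>nbrs v. nbrs u - {v}"] 6 card_nbrs[OF assms] by linarith
  finally show ?thesis by simp
qed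

lemma ball2_sym: "z \<in> ball2 w \<Longrightarrow> w \<in> ball2 z"
  unfolding ball2_def using nbrs_sym by blast

lemma card_overlap:
  assumes "v \<in> V"
  shows "card {w \<in> V. ball2 v \<inter> ball2 w \<noteq> {}} \<le> 100"
proof -
  have "{w \<in> V. ball2 v \<inter> ball2 w \<noteq> {}} \<subseteq> (\<Union>z\<in>ball2 v. ball2 z)"
    using ball2_sym by blast
  then have "card {w \<in> V. ball2 v \<inter> ball2 w \<noteq> {}} \<le> card (\<Union>z\<in>ball2 v. ball2 z)"
    by (rule card_mono[rotated]) (auto simp: finite_ball2)
  also have "\<dots> \<le> (\<Sum>z\<in>ball2 v. card (ball2 z))" by (rule card_UN_le[OF finite_ball2])
  also have "\<dots> \<le> (\<Sum>z\<in>ball2 v. 10)"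
    by (rule sum_mono) (use card_ball2 ball2_sub in blast)
  also have "\<dots> \<le> 100" using card_ball2[OF assms] by simp
  finally show ?thesis .
qed

text \<open>
  The local maxima are independent and meet \<open>3\<close> edges each, so the core has
  \<open>3n/2 - 3 card (local_maxima \<pi>)\<close> edges.
\<close>

lemma inner_arcs_core:
  assumes "distinct \<pi>"
  shows "inner_arcs P (core \<pi>) + 6 * card (local_maxima \<pi>) = 3 * card V"
proof -
  let ?D = "local_maxima \<pi>"
  have finP: "finite P" using P_sub finite_V finite_subset by blast
  have DV: "?D \<subseteq> V" and finD: "finite ?D" using finite_V by (auto simp: local_maxima_def)
  have card_out: "card (SIGMA v:A. nbrs v) = 3 * card A" if "A \<subseteq> V" for A
  proof -
    have "finite A" using that finite_V finite_subset by blast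
    then have "card (SIGMA v:A. nbrs v) = (\<Sum>v\<in>A. card (nbrs v))"
      by (rule card_SigmaI) (simp add: finite_nbrs)
    also have "\<dots> = (\<Sum>v\<in>A. 3)" by (rule sum.cong) (use that card_nbrs in auto)
    finally show ?thesis by simp
  qed
  have indep: "v \<notin> ?D" if "u \<in> ?D" "(u, v) \<in> P" for u v
  proof
    assume "v \<in> ?D"
    moreover have "v \<in> nbrs u" using that by (simp add: nbrs_def)
    ultimately have "precedes \<pi> u v" "precedes \<pi> v u"
      using that nbrs_sym by (simp_all add: local_maxima_def)
    then show False using precedes_antisym assms by fast
  qed
  let ?O = "SIGMA v:?D. nbrs v"
  have finO: "finite ?O" using finD finite_nbrs by auto
  have core: "P \<inter> core \<pi> \<times> core \<pi> = P - ?O - prod.swap ` ?O"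
  proof (intro equalityI subsetI)
    fix e assume "e \<in> P \<inter> core \<pi> \<times> core \<pi>"
    then show "e \<in> P - ?O - prod.swap ` ?O" by (auto simp: core_def)
  next
    fix e assume e: "e \<in> P - ?O - prod.swap ` ?O"
    obtain u v where uv: "e = (u, v)" by fastforce
    then have P: "(u, v) \<in> P" "(v, u) \<in> P" using e sym_P by (auto elim: symE)
    have "u \<notin> ?D" using e uv P by (auto simp: nbrs_def)
    moreover have "v \<notin> ?D"
    proof
      assume "v \<in> ?D"
      then have "(v, u) \<in> ?O" using P by (simp add: nbrs_def)
      then have "prod.swap (v, u) \<in> prod.swap ` ?O" by (rule imageI)
      then show False using e uv by simp
    qed
    moreover have "u \<in> V" "v \<in> V" using P P_sub by auto
    \<comment> \<open>All neighbours of an isolated vertex are in \<open>?D\<close>, so it lies on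
      no remaining arc. Removing the isolated vertices loses no edge.\<close>
    moreover have "u \<notin> isolated \<pi>" "v \<notin> isolated \<pi>"
      using calculation P by (auto simp: isolated_def nbrs_def)
    ultimately show "e \<in> P \<inter> core \<pi> \<times> core \<pi>" using uv P by (simp add: core_def)
  qed
  have "P = (SIGMA v:V. nbrs v)" using P_sub by (auto simp: nbrs_def)
  then have cP: "card P = 3 * card V" using card_out[of V] by simp
  have OP: "?O \<subseteq> P" by (auto simp: nbrs_def)
  have OP': "prod.swap ` ?O \<subseteq> P" using nbrs_sym by (auto simp: nbrs_def)
  have disj: "?O \<inter> prod.swap ` ?O = {}" using indep by (auto simp: nbrs_def)
  have "card (prod.swap ` ?O) = card ?O" by (rule card_image) (auto simp: inj_on_def)
  then have "card (?O \<union> prod.swap ` ?O) = 6 * card ?D"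
    using card_Un_disjoint[OF finO _ disj] finO card_out[OF DV] by simp
  moreover have "P - ?O - prod.swap ` ?O = P - (?O \<union> prod.swap ` ?O)" by blast
  moreover have "card (P - (?O \<union> prod.swap ` ?O)) = card P - card (?O \<union> prod.swap ` ?O)"
    by (rule card_Diff_subset) (use OP OP' finO in auto)
  moreover have "card (?O \<union> prod.swap ` ?O) \<le> card P"
    by (rule card_mono[OF finP]) (use OP OP' in blast)
  ultimately show ?thesis unfolding inner_arcs_def core cP by simp
qed

lemma card_core:
  assumes "distinct \<pi>"
  shows "card (core \<pi>) + card (local_maxima \<pi>) + card (isolated \<pi>) = card V"
proof -
  have "v \<notin> local_maxima \<pi>" if v: "v \<in> isolated \<pi>" for v
  proof
    assume M: "v \<in> local_maxima \<pi>"
    obtain u where u: "u \<in> nbrs v" using v nbrs_nonempty by (auto simp: isolated_def)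
    then have "u \<in> local_maxima \<pi>" "v \<in> nbrs u" using v nbrs_sym by (auto simp: isolated_def)
    then have "precedes \<pi> u v" "precedes \<pi> v u" using M u by (simp_all add: local_maxima_def)
    then show False using precedes_antisym assms by fast
  qed
  then have disj: "local_maxima \<pi> \<inter> isolated \<pi> = {}" by blast
  have sub: "local_maxima \<pi> \<subseteq> V" "isolated \<pi> \<subseteq> V" by (auto simp: local_maxima_def isolated_def)
  then have fin: "finite (local_maxima \<pi>)" "finite (isolated \<pi>)"
    using finite_V finite_subset by blast+
  have "core \<pi> = V - (local_maxima \<pi> \<union> isolated \<pi>)" by (auto simp: core_def)
  then have "card (core \<pi>) = card V - card (local_maxima \<pi> \<union> isolated \<pi>)"
    using card_Diff_subset[of "local_maxima \<pi> \<union> isolated \<pi>" V] fin sub by simp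
  moreover have "card (local_maxima \<pi> \<union> isolated \<pi>) \<le> card V"
    by (rule card_mono[OF finite_V]) (use sub in blast)
  ultimately show ?thesis using card_Un_disjoint[OF fin disj] by simp
qed

text \<open>The share of \<open>v\<close> in the edges minus the vertices of the core. With local
  maxima D and isolated vertices I this difference is (3n/2 - 3|D|) - (n - |D| - |I|) = n/2 - 2|D| +
  |I|.\<close>

definition local_excess :: "'a \<Rightarrow> 'a list \<Rightarrow> real" where
  "local_excess v \<pi> = 1 / 2 - 2 * of_bool (\<forall>u\<in>nbrs v. precedes \<pi> u v)
    + of_bool (\<forall>u\<in>nbrs v. \<forall>w\<in>nbrs u. precedes \<pi> w u)"

lemma sum_local_excess:
  assumes "distinct \<pi>"
  shows "2 * (\<Sum>v\<in>V. local_excess v \<pi>) = real (inner_arcs P (core \<pi>)) - 2 * real (card (core \<pi>))"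
proof -
  have iso: "isolated \<pi> = {v \<in> V. \<forall>u\<in>nbrs v. \<forall>w\<in>nbrs u. precedes \<pi> w u}"
    using nbrs_sub by (fastforce simp: isolated_def local_maxima_def)
  have count: "(\<Sum>v\<in>V. of_bool (Q v)) = real (card {v \<in> V. Q v})" for Q
    using sum.inter_filter[OF finite_V, of "\<lambda>_. 1 :: real" Q] by (simp add: of_bool_def)
  have "(\<Sum>v\<in>V. local_excess v \<pi>) =
      real (card V) / 2 - 2 * real (card (local_maxima \<pi>)) + real (card (isolated \<pi>))"
    unfolding local_excess_def iso local_maxima_def
    by (simp add: sum.distrib sum_subtractf count flip: sum_distrib_left)
  moreover have "real (inner_arcs P (core \<pi>)) + 6 * real (card (local_maxima \<pi>)) = 3 * real (card V)"
    using inner_arcs_core[OF assms] by linarith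
  moreover have "real (card (core \<pi>)) + real (card (local_maxima \<pi>)) + real (card (isolated \<pi>)) = real (card V)"
    using card_core[OF assms] by linarith
  ultimately show ?thesis by argo
qed

lemma local_excess_filter:
  assumes "v \<in> V"
  shows "local_excess v (filter (\<lambda>x. x \<in> ball2 v) \<pi>) = local_excess v \<pi>"
proof -
  obtain u where "u \<in> nbrs v" "v \<in> nbrs u" using assms nbrs_nonempty nbrs_sym by blast
  then have v: "v \<in> ball2 v" by (auto simp: ball2_def)
  have 1: "precedes (filter (\<lambda>x. x \<in> ball2 v) \<pi>) u v \<longleftrightarrow> precedes \<pi> u v" if "u \<in> nbrs v" for u
    using that v by (intro precedes_filter) (auto simp: ball2_def)
  have 2: "precedes (filter (\<lambda>x. x \<in> ball2 v) \<pi>) w u \<longleftrightarrow> precedes \<pi> w u"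
    if "u \<in> nbrs v" "w \<in> nbrs u" for u w
    using that by (intro precedes_filter) (auto simp: ball2_def)
  show ?thesis unfolding local_excess_def using 1 2 by simp
qed

text \<open>\<open>v\<close> comes last among itself and its neighbours with probability 1/4, so the
  first two terms cancel on average and only the isolated vertices contribute.\<close>

lemma sum_local_excess_orderings:
  assumes v: "v \<in> V"
  shows "1 / 120 * fact (card V) \<le> (\<Sum>\<pi>\<in>permutations_of_set V. local_excess v \<pi>)"
proof -
  let ?S = "permutations_of_set V"
  let ?M = "{\<pi> \<in> ?S. \<forall>u\<in>nbrs v. precedes \<pi> u v}"
  let ?I = "{\<pi> \<in> ?S. \<forall>u\<in>nbrs v. \<forall>w\<in>nbrs u. precedes \<pi> w u}"
  have count: "(\<Sum>\<pi>\<in>?S. of_bool (Q \<pi>)) = real (card {\<pi> \<in> ?S. Q \<pi>})" for Q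
    using sum.inter_filter[of ?S "\<lambda>_. 1 :: real" Q] by (simp add: of_bool_def)
  have sum: "(\<Sum>\<pi>\<in>?S. local_excess v \<pi>) = fact (card V) / 2 - 2 * real (card ?M) + real (card ?I)"
    unfolding local_excess_def using finite_V
    by (simp add: sum.distrib sum_subtractf count flip: sum_distrib_left)
  have "insert v (nbrs v) - {v} = nbrs v" using not_nbr_self by auto
  then have "card ?M * (card (insert v (nbrs v)) choose 1) = fact (card V)"
    using card_orderings_ending_in[OF finite_V, of "insert v (nbrs v)" "{v}"] v nbrs_sub by simp
  moreover have "card (insert v (nbrs v)) = 4"
    using card_nbrs[OF v] not_nbr_self finite_nbrs by simp
  ultimately have "card ?M * 4 = fact (card V)" by simp
  then have "real (card ?M * 4) = real (fact (card V))" by (rule arg_cong)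
  then have M: "4 * real (card ?M) = fact (card V)" by simp
  let ?E = "{\<pi> \<in> ?S. \<forall>z\<in>ball2 v - nbrs v. \<forall>u\<in>nbrs v. precedes \<pi> z u}"
  \<comment> \<open>Without triangles, neighbours of a neighbour of \<open>v\<close> are not
    neighbours of \<open>v\<close>. So if \<open>nbrs v\<close> comes last in the ball, each of its
    members comes after all of its own neighbours.\<close>
  have "w \<in> ball2 v - nbrs v" if "u \<in> nbrs v" "w \<in> nbrs u" for u w
    using that triangle_free[of v u w] by (auto simp: ball2_def nbrs_def)
  then have "?E \<subseteq> ?I" by blast
  then have EI: "card ?E \<le> card ?I" by (rule card_mono[rotated]) simp
  have E: "card ?E * (card (ball2 v) choose 3) = fact (card V)"
    using card_orderings_ending_in[OF finite_V ball2_sub[of v], of "nbrs v"] card_nbrs[OF v]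
    by (simp add: ball2_def)
  have "card (ball2 v) choose 3 \<le> 10 choose 3" by (rule binomial_right_mono[OF card_ball2[OF v]])
  also have "\<dots> = 120" by (simp add: numeral_eq_Suc)
  finally have "card ?E * (card (ball2 v) choose 3) \<le> card ?I * 120"
    using EI by (intro mult_le_mono)
  then have "real (fact (card V)) \<le> real (card ?I * 120)" unfolding E by (rule of_nat_mono)
  then have "fact (card V) \<le> 120 * real (card ?I)" by simp
  then show ?thesis unfolding sum using M by linarith
qed

text \<open>The second moment bound with mean 1/120, values bounded by 2 and at most 100 overlapping
  balls: 100 * (2 * 2) ^ 2 = 1600.\<close>

lemma card_small_excess_orderings:
  "real (card {\<pi> \<in> permutations_of_set V. (\<Sum>v\<in>V. local_excess v \<pi>) \<le> real (card V) / 240})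
    * (real (card V) / 240)\<^sup>2 \<le> 1600 * real (card V) * fact (card V)"
proof -
  have "real (card {\<pi> \<in> permutations_of_set V.
        (\<Sum>v\<in>V. local_excess v (filter (\<lambda>x. x \<in> ball2 v) \<pi>)) \<le> 1 / 120 / 2 * real (card V)})
      * (1 / 120 / 2 * real (card V))\<^sup>2 \<le> real (card V) * real 100 * (2 * 2)\<^sup>2 * fact (card V)"
  proof (rule orderings_second_moment[OF finite_V ball2_sub])
    show "\<bar>local_excess v xs\<bar> \<le> 2" for v xs by (simp add: local_excess_def of_bool_def)
    show "1 / 120 * fact (card V) \<le>
        (\<Sum>\<pi>\<in>permutations_of_set V. local_excess v (filter (\<lambda>x. x \<in> ball2 v) \<pi>))" if "v \<in> V" for v
      using sum_local_excess_orderings[OF that] local_excess_filter[OF that] by simp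
  qed (use card_overlap in auto)
  then show ?thesis by (simp add: local_excess_filter cong: sum.cong)
qed

end

section \<open>From the excess to large components and large treewidth\<close>

context triangle_free_cubic
begin

text \<open>The core has more than \<open>card V / 240\<close> surplus edges, hence a density above
  1 + 1/240, whereas sparseness allows only 1 + 1/480.\<close>

lemma core_not_sparse:
  assumes "distinct \<pi>" and ex: "real (card V) / 240 < (\<Sum>v\<in>V. local_excess v \<pi>)"
  shows "\<not> sparse_arcs P 480 (core \<pi>)"
proof
  assume "sparse_arcs P 480 (core \<pi>)"
  then have "480 * inner_arcs P (core \<pi>) \<le> 962 * card (core \<pi>)" by (simp add: sparse_arcs_def)
  then have "480 * real (inner_arcs P (core \<pi>)) \<le> 962 * real (card (core \<pi>))" by linarith
  moreover have "real (card (core \<pi>)) \<le> real (card V)" using card_core[OF assms(1)] by linarith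
  ultimately show False using sum_local_excess[OF assms(1)] ex by linarith
qed

text \<open>The constant is 1600 * 240 ^ 2.\<close>

lemma prob_ordering_ge:
  assumes V: "V \<noteq> {}"
    and X: "\<And>\<pi>. \<pi> \<in> permutations_of_set V \<Longrightarrow> real (card V) / 240 < (\<Sum>v\<in>V. local_excess v \<pi>) \<Longrightarrow> \<pi> \<in> X"
  shows "1 - 92160000 / real (card V) \<le> measure_pmf.prob (pmf_of_set (permutations_of_set V)) X"
proof -
  let ?S = "permutations_of_set V"
  let ?bad = "{\<pi> \<in> ?S. (\<Sum>v\<in>V. local_excess v \<pi>) \<le> real (card V) / 240}"
  have n: "real (card V) > 0" using V finite_V by (simp add: card_gt_0_iff)
  have S: "?S \<noteq> {}" "finite ?S" "card ?S = fact (card V)" using finite_V by auto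
  have "?S \<subseteq> ?bad \<union> (?S \<inter> X)" using X not_le by blast
  then have "card ?S \<le> card (?bad \<union> (?S \<inter> X))" by (rule card_mono[rotated]) simp
  also have "\<dots> \<le> card ?bad + card (?S \<inter> X)" by (rule card_Un_le)
  finally have "real (card ?S) \<le> real (card ?bad + card (?S \<inter> X))" by (rule of_nat_mono)
  then have le: "fact (card V) - real (card ?bad) \<le> real (card (?S \<inter> X))" using S(3) by simp
  have "real (card ?bad) * (real (card V) / 240)\<^sup>2 \<le> 1600 * real (card V) * fact (card V)"
    by (rule card_small_excess_orderings)
  then have "real (card V) * (real (card ?bad) * real (card V)) \<le> real (card V) * (92160000 * fact (card V))"
    by (simp add: power2_eq_square field_simps)
  then have bad: "real (card ?bad) * real (card V) \<le> 92160000 * fact (card V)"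
    using n by (rule mult_left_le_imp_le)
  have "real (card ?bad) / fact (card V) \<le> 92160000 / real (card V)"
    using bad n by (simp add: divide_simps mult.commute)
  moreover have "1 - real (card ?bad) / fact (card V) \<le> real (card (?S \<inter> X)) / fact (card V)"
    using divide_right_mono[OF le, of "fact (card V)"] by (simp add: diff_divide_distrib)
  ultimately show ?thesis using measure_pmf_of_set[OF S(1,2), of X] S(3) by simp
qed

end

lemma regular_graph_triangle_free_cubic:
  assumes G: "regular_graph 3 (with_proj G)"
    and tf: "\<And>u v w. (u, v) \<in> parcs G \<Longrightarrow> (v, w) \<in> parcs G \<Longrightarrow> (u, w) \<notin> parcs G"
  shows "triangle_free_cubic (pverts G) (parcs G)"
proof -
  interpret pair_graph G using G by (intro pair_graphI_graph) (simp add: regular_graph_def)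
  show ?thesis
  proof
    show "finite (pverts G)" by (rule pair_finite_verts)
    show "parcs G \<subseteq> pverts G \<times> pverts G" using in_arcsD1 in_arcsD2 by auto
    show "sym (parcs G)" using sym_arcs by (simp add: symmetric_def)
    show "(u, w) \<notin> parcs G" if "(u, v) \<in> parcs G" "(v, w) \<in> parcs G" for u v w by (rule tf[OF that])
    show "card {u. (v, u) \<in> parcs G} = 3" if "v \<in> pverts G" for v
    proof -
      have "out_arcs (with_proj G) v = Pair v ` {u. (v, u) \<in> parcs G}" by (auto simp: out_arcs_def)
      then have "out_degree (with_proj G) v = card {u. (v, u) \<in> parcs G}"
        by (simp add: out_degree_def card_image inj_on_def)
      then show ?thesis using G that by (simp add: regular_graph_def)
    qed
  qed
qed

text \<open>Here \<kappa> is a number of vertices, not a proportion; it will be a multiple of the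
  size of the graph.\<close>

locale sparse_cubic_graph = triangle_free_cubic "pverts G" "parcs G" for G :: "'a pair_pre_digraph" +
  fixes \<kappa> :: real
  assumes sparse: "S \<subseteq> pverts G \<Longrightarrow> real (card S) \<le> \<kappa> \<Longrightarrow> sparse_arcs (parcs G) 480 S"
begin

abbreviation survivors :: "'a list \<Rightarrow> 'a set" where
  "survivors \<pi> \<equiv> pverts G - local_maxima \<pi>"

text \<open>In a cubic graph a vertex misses the first three layers exactly if all three of its
  neighbours precede it.\<close>

lemma layer_graph_3: "layer_graph 3 (with_proj G) \<pi> = with_proj G \<restriction> survivors \<pi>"
proof -
  have "v \<in> (\<Union>i\<in>{1..3}. layer i (with_proj G) \<pi>) \<longleftrightarrow> v \<in> survivors \<pi>" for v
  proof (cases "v \<in> pverts G")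
    case True
    let ?A = "{u \<in> pverts G. (u, v) \<in> parcs G \<and> precedes \<pi> u v}"
    have A: "?A = {u \<in> nbrs v. precedes \<pi> u v}"
      using nbrs_sym nbrs_sub by (auto simp: nbrs_def)
    have "v \<in> (\<Union>i\<in>{1..3}. layer i (with_proj G) \<pi>) \<longleftrightarrow> (\<exists>i\<in>{1..3}. card ?A = i - 1)"
      using True by (simp add: layer_def)
    also have "\<dots> \<longleftrightarrow> card ?A < 3"
      by (auto intro!: bexI[of _ "Suc (card ?A)"])
    also have "\<dots> \<longleftrightarrow> ?A \<noteq> nbrs v"
    proof
      assume "?A \<noteq> nbrs v"
      then have "?A \<subset> nbrs v" unfolding A by blast
      then show "card ?A < 3" using psubset_card_mono[OF finite_nbrs] card_nbrs[OF True] by metis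
    qed (use card_nbrs[OF True] in auto)
    also have "\<dots> \<longleftrightarrow> v \<in> survivors \<pi>" unfolding A using True by (auto simp: local_maxima_def)
    finally show ?thesis .
  qed (simp add: layer_def)
  then have "(\<Union>i\<in>{1..3}. layer i (with_proj G) \<pi>) = survivors \<pi>" by blast
  then show ?thesis by (simp add: layer_graph_def)
qed

lemma core_subset_survivors: "core \<pi> \<subseteq> survivors \<pi>"
  by (auto simp: core_def)

lemma sym_digraph_survivors: "sym_digraph (with_proj G \<restriction> survivors \<pi>)"
proof
  show "symmetric (with_proj G \<restriction> survivors \<pi>)"
    using sym_P unfolding symmetric_def arcs_ends_induce_with_proj by (auto simp: sym_def)
qed auto

text \<open>If all components were small, the parts of the core inside them would be sparse; no arc
  joins two of them, so the whole core would be sparse.\<close>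

lemma ex_large_component:
  assumes "distinct \<pi>" and ex: "real (card (pverts G)) / 240 < (\<Sum>v\<in>pverts G. local_excess v \<pi>)"
  shows "\<exists>C\<in>pre_digraph.sccs (with_proj G \<restriction> survivors \<pi>). \<kappa> \<le> real (card (verts C))"
proof (rule ccontr)
  let ?H = "with_proj G \<restriction> survivors \<pi>"
  interpret H: sym_digraph ?H by (rule sym_digraph_survivors)
  assume "\<not> (\<exists>C\<in>pre_digraph.sccs ?H. \<kappa> \<le> real (card (verts C)))"
  then have small: "real (card S) \<le> \<kappa>" if "S \<in> H.sccs_verts" for S
    using that unfolding H.sccs_verts_conv by force
  have "sparse_arcs (parcs G) 480 (core \<pi>)"
  proof (rule sparse_arcs_fibres[where f = H.scc_of])
    show "finite (core \<pi>)" using finite_V by (simp add: core_def)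
    show "H.scc_of u = H.scc_of v" if uv: "(u, v) \<in> parcs G" "u \<in> core \<pi>" "v \<in> core \<pi>" for u v
    proof -
      have "(u, v) \<in> arcs_ends ?H"
        using uv core_subset_survivors unfolding arcs_ends_induce_with_proj by blast
      then have "u \<rightarrow>\<^sup>*\<^bsub>?H\<^esub> v" "v \<rightarrow>\<^sup>*\<^bsub>?H\<^esub> u" using H.graph_symmetric by auto
      then show ?thesis unfolding H.scc_of_def by (blast intro: H.reachable_trans)
    qed
    show "sparse_arcs (parcs G) 480 {v \<in> core \<pi>. H.scc_of v = c}" if c: "c \<in> H.scc_of ` core \<pi>" for c
    proof (rule sparse)
      have cs: "c \<in> H.sccs_verts"
        using c H.scc_of_in_sccs_verts core_subset_survivors by fastforce
      have "{v \<in> core \<pi>. H.scc_of v = c} \<subseteq> c"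
        using H.in_scc_of_self core_subset_survivors by fastforce
      moreover have "c \<subseteq> pverts G" using H.sccs_verts_subsets[OF cs] by auto
      then have "finite c" using finite_V finite_subset by blast
      ultimately have "card {v \<in> core \<pi>. H.scc_of v = c} \<le> card c" by (intro card_mono)
      then show "real (card {v \<in> core \<pi>. H.scc_of v = c}) \<le> \<kappa>" using small[OF cs] by linarith
    qed (auto simp: core_def)
  qed
  then show False using core_not_sparse[OF assms] by contradiction
qed

text \<open>The factor 1440 is half of 2 * 3 * 480, from removing bags in degree at most 3 with
  \<open>L = 480\<close>; the final \<open>+ 1\<close> is the rounding of \<kappa>.\<close>

lemma treewidth_ge:
  assumes \<pi>: "distinct \<pi>" and ex: "real (card (pverts G)) / 240 < (\<Sum>v\<in>pverts G. local_excess v \<pi>)"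
  shows "\<kappa> \<le> 1440 * (real (treewidth (with_proj G \<restriction> survivors \<pi>)) + 1) + 1"
proof (cases "\<kappa> \<le> 0")
  case True
  then show ?thesis by (simp add: order_trans[OF True])
next
  case False
  let ?H = "with_proj G \<restriction> survivors \<pi>" and ?c = "card (core \<pi>)"
  define K where "K = nat \<lfloor>\<kappa>\<rfloor>"
  have K: "real K \<le> \<kappa>" "\<kappa> \<le> real K + 1" using False unfolding K_def by linarith+
  interpret H: sym_digraph ?H by (rule sym_digraph_survivors)
  have ends: "arcs_ends ?H = parcs G \<inter> survivors \<pi> \<times> survivors \<pi>" by (rule arcs_ends_induce_with_proj)
  have finP: "finite (parcs G)" using P_sub finite_V finite_subset by blast
  obtain T :: "nat pair_pre_digraph" and B where TB: "tree_decomposition ?H (with_proj T) B"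
    and w: "decomposition_width (with_proj T) B = treewidth ?H"
    using treewidth_attained[OF H.wf_digraph] by metis
  have "K * 480 * inner_arcs (arcs_ends ?H) (core \<pi>) \<le> 2 * K * (480 + 1) * ?c +
    2 * 3 * (decomposition_width (with_proj T) B + 1) * 480 * ?c"
  proof (rule tree_decomposition_inner_arcs_bound[OF TB])
    show "finite (verts ?H)" using finite_V by simp
    show "sym (arcs_ends ?H)" using H.sym_arcs by (simp add: symmetric_def)
    fix v assume v: "v \<in> verts ?H"
    have sub: "{u. (v, u) \<in> arcs_ends ?H} \<subseteq> nbrs v" unfolding ends nbrs_def by blast
    show "finite {u. (v, u) \<in> arcs_ends ?H}" by (rule finite_subset[OF sub finite_nbrs])
    show "card {u. (v, u) \<in> arcs_ends ?H} \<le> 3"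
      using card_mono[OF finite_nbrs sub] card_nbrs[of v] v by simp
  next
    fix S assume S: "S \<subseteq> verts ?H" "card S \<le> K"
    have "sparse_arcs (parcs G) 480 S"
      by (rule sparse) (use S K in auto)
    moreover have "inner_arcs (arcs_ends ?H) S \<le> inner_arcs (parcs G) S"
      unfolding inner_arcs_def ends by (rule card_mono) (use finP in auto)
    ultimately show "sparse_arcs (arcs_ends ?H) 480 S" unfolding sparse_arcs_def by linarith
  qed (use core_subset_survivors in simp)
  moreover have "inner_arcs (arcs_ends ?H) (core \<pi>) = inner_arcs (parcs G) (core \<pi>)"
    unfolding inner_arcs_def ends using core_subset_survivors by (intro arg_cong[where f = card]) blast
  ultimately have "K * (480 * inner_arcs (parcs G) (core \<pi>)) \<le> (962 * K + 2880 * (treewidth ?H + 1)) * ?c"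
    unfolding w by (simp add: algebra_simps)
  then have "real (K * (480 * inner_arcs (parcs G) (core \<pi>))) \<le>
      real ((962 * K + 2880 * (treewidth ?H + 1)) * ?c)"
    by (rule of_nat_mono)
  then have up: "real K * (480 * real (inner_arcs (parcs G) (core \<pi>))) \<le>
      (962 * real K + 2880 * (real (treewidth ?H) + 1)) * real ?c"
    by (simp add: add.commute)
  \<comment> \<open>480 times the arc count, which exceeds \<open>2 * ?c\<close> by more than
    \<open>card (pverts G) / 120\<close>.\<close>
  have "960 * real ?c + 4 * real (card (pverts G)) \<le> 480 * real (inner_arcs (parcs G) (core \<pi>))"
    using sum_local_excess[OF \<pi>] ex by linarith
  then have "real K * (960 * real ?c + 4 * real (card (pverts G))) \<le>
      real K * (480 * real (inner_arcs (parcs G) (core \<pi>)))"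
    by (rule mult_left_mono) simp
  also note up
  finally have *: "4 * real K * real (card (pverts G)) \<le>
      (2 * real K + 2880 * (real (treewidth ?H) + 1)) * real ?c"
    by (simp add: algebra_simps)
  \<comment> \<open>Bounding the core by all vertices lets their number cancel. Of the surplus
    \<open>4 * K\<close>, sparseness uses up \<open>2 * K\<close>; the rest must come from the
    bags.\<close>
  also have "\<dots> \<le> (2 * real K + 2880 * (real (treewidth ?H) + 1)) * real (card (pverts G))"
    by (rule mult_left_mono) (use card_core[OF \<pi>] in auto)
  finally have "4 * real K \<le> 2 * real K + 2880 * (real (treewidth ?H) + 1)"
  proof (rule mult_right_le_imp_le)
    have "pverts G \<noteq> {}" using ex by auto
    then show "0 < real (card (pverts G))" using finite_V by (simp add: card_gt_0_iff)
  qed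
  then show ?thesis using K by linarith
qed

end

section \<open>The sequence of graphs and the limits\<close>

lemma ex_sparse_cubic_graphs:
  obtains \<kappa> :: real and G :: "nat \<Rightarrow> nat pair_pre_digraph"
  where "\<kappa> > 0" "\<And>i. regular_graph 3 (with_proj (G i))" "\<And>i. card (pverts (G i)) = 6 * Suc i"
    "\<And>i. sparse_cubic_graph (G i) (\<kappa> * real (Suc i))"
proof -
  let ?\<kappa> = "(1 / 432) ^ 480 / 6 :: real"
  have "\<exists>G :: nat pair_pre_digraph. regular_graph 3 (with_proj G) \<and> card (pverts G) = 6 * Suc i \<and>
      sparse_cubic_graph G (?\<kappa> * real (Suc i))" for i
  proof -
    obtain G :: "nat pair_pre_digraph" where G: "regular_graph 3 (with_proj G)" "card (pverts G) = 6 * Suc i"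
      "\<And>u v w. (u, v) \<in> parcs G \<Longrightarrow> (v, w) \<in> parcs G \<Longrightarrow> (u, w) \<notin> parcs G"
      "\<And>S. S \<subseteq> pverts G \<Longrightarrow> real (card S) \<le> ?\<kappa> * real (Suc i) \<Longrightarrow> sparse_arcs (parcs G) 480 S"
      using ex_sparse_cubic_graph[of "Suc i" 480] by (metis One_nat_def Suc_le_mono le0 one_le_numeral)
    interpret triangle_free_cubic "pverts G" "parcs G"
      by (rule regular_graph_triangle_free_cubic[OF G(1,3)])
    have "sparse_cubic_graph G (?\<kappa> * real (Suc i))" by unfold_locales (rule G(4))
    then show ?thesis using G(1,2) by blast
  qed
  then obtain G :: "nat \<Rightarrow> nat pair_pre_digraph" where "\<And>i. regular_graph 3 (with_proj (G i)) \<and>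
      card (pverts (G i)) = 6 * Suc i \<and> sparse_cubic_graph (G i) (?\<kappa> * real (Suc i))"
    by metis
  moreover have "?\<kappa> > 0" by (intro divide_pos_pos zero_less_power) auto
  ultimately show ?thesis using that by blast
qed

theorem theorem1p2:
  shows "\<exists>(G :: nat \<Rightarrow> nat pair_pre_digraph) (\<delta> :: real).
    (\<forall>i. regular_graph 3 (with_proj (G i))) \<and>
    filterlim (\<lambda>i. card (pverts (G i))) at_top sequentially \<and>
    \<delta> > 0 \<and>
    (\<lambda>i. measure_pmf.prob (random_ordering (with_proj (G i)))
       {\<pi>. \<exists>C \<in> pre_digraph.sccs (layer_graph 3 (with_proj (G i)) \<pi>).
             real (card (verts C)) \<ge> \<delta> * real (card (pverts (G i)))}) \<longlonglongrightarrow> 1 \<and>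
    (\<exists>c :: real. c > 0 \<and>
      (\<lambda>i. measure_pmf.prob (random_ordering (with_proj (G i)))
         {\<pi>. real (treewidth (layer_graph 3 (with_proj (G i)) \<pi>)) \<ge> c * real (card (pverts (G i)))}) \<longlonglongrightarrow> 1)"
proof -
  obtain \<kappa> :: real and G :: "nat \<Rightarrow> nat pair_pre_digraph" where \<kappa>: "\<kappa> > 0"
    and reg: "\<And>i. regular_graph 3 (with_proj (G i))"
    and card: "\<And>i. card (pverts (G i)) = 6 * Suc i"
    and sparse: "\<And>i. sparse_cubic_graph (G i) (\<kappa> * real (Suc i))"
    using ex_sparse_cubic_graphs by blast
  have lower: "(\<lambda>i. 1 - 92160000 / real (6 * Suc i)) \<longlonglongrightarrow> 1" by real_asymp
  \<comment> \<open>Both claims reduce to the event of large excess. They may fail for small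
    \<open>i\<close>, where the additive constants of the treewidth bound still matter.\<close>
  have squeeze: "(\<lambda>i. measure_pmf.prob (random_ordering (with_proj (G i))) (X i)) \<longlonglongrightarrow> 1"
    if "\<forall>\<^sub>F i in sequentially. \<forall>\<pi>\<in>permutations_of_set (pverts (G i)).
      real (card (pverts (G i))) / 240 < (\<Sum>v\<in>pverts (G i). triangle_free_cubic.local_excess (parcs (G i)) v \<pi>)
        \<longrightarrow> \<pi> \<in> X i" for X
  proof (rule tendsto_sandwich[OF _ _ lower tendsto_const])
    show "\<forall>\<^sub>F i in sequentially. 1 - 92160000 / real (6 * Suc i) \<le>
      measure_pmf.prob (random_ordering (with_proj (G i))) (X i)"
      using that
    proof eventually_elim
      case (elim i)
      interpret sparse_cubic_graph "G i" "\<kappa> * real (Suc i)" by (rule sparse)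
      have "pverts (G i) \<noteq> {}" using card[of i] by auto
      from prob_ordering_ge[OF this, of "X i"] elim show ?case
        by (simp add: card random_ordering_def)
    qed
  qed simp
  show ?thesis
  proof (rule exI[of _ G], rule exI[of _ "\<kappa> / 6"], intro conjI allI reg)
    show "filterlim (\<lambda>i. card (pverts (G i))) at_top sequentially"
      unfolding card by (rule filterlim_subseq) (simp add: strict_mono_def)
    show "0 < \<kappa> / 6" using \<kappa> by simp
    show "(\<lambda>i. measure_pmf.prob (random_ordering (with_proj (G i)))
       {\<pi>. \<exists>C \<in> pre_digraph.sccs (layer_graph 3 (with_proj (G i)) \<pi>).
             real (card (verts C)) \<ge> \<kappa> / 6 * real (card (pverts (G i)))}) \<longlonglongrightarrow> 1"
    proof (rule squeeze, rule always_eventually, intro allI ballI impI CollectI)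
      fix i \<pi> assume "\<pi> \<in> permutations_of_set (pverts (G i))"
      then have \<pi>: "distinct \<pi>" by (rule permutations_of_setD)
      interpret sparse_cubic_graph "G i" "\<kappa> * real (Suc i)" by (rule sparse)
      assume ex: "real (card (pverts (G i))) / 240 < (\<Sum>v\<in>pverts (G i). local_excess v \<pi>)"
      have eq: "\<kappa> / 6 * real (6 * Suc i) = \<kappa> * real (Suc i)" by simp
      show "\<exists>C \<in> pre_digraph.sccs (layer_graph 3 (with_proj (G i)) \<pi>).
             real (card (verts C)) \<ge> \<kappa> / 6 * real (card (pverts (G i)))"
        using ex_large_component[OF \<pi> ex] unfolding layer_graph_3 card eq .
    qed
    show "\<exists>c :: real. c > 0 \<and>
      (\<lambda>i. measure_pmf.prob (random_ordering (with_proj (G i)))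
         {\<pi>. real (treewidth (layer_graph 3 (with_proj (G i)) \<pi>)) \<ge> c * real (card (pverts (G i)))}) \<longlonglongrightarrow> 1"
    proof (rule exI[of _ "\<kappa> / 17280"], rule conjI)
      show "0 < \<kappa> / 17280" using \<kappa> by simp
      \<comment> \<open>With x for the right side, x \<le> 1440 * (w + 1) + 1 gives w \<ge> (x -
        1441) / 1440, which is at least x / 2880 once x \<ge> 2 * 1441. As there are
        \<open>6 * Suc i\<close> vertices, c is \<kappa> / (6 * 2880).\<close>
      have big: "\<forall>\<^sub>F i in sequentially. 2882 \<le> \<kappa> * real (Suc i)"
        using \<kappa> by real_asymp
      show "(\<lambda>i. measure_pmf.prob (random_ordering (with_proj (G i)))
         {\<pi>. real (treewidth (layer_graph 3 (with_proj (G i)) \<pi>)) \<ge>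
           \<kappa> / 17280 * real (card (pverts (G i)))}) \<longlonglongrightarrow> 1"
      proof (rule squeeze, rule eventually_mono[OF big], intro ballI impI CollectI)
        fix i \<pi> assume big: "2882 \<le> \<kappa> * real (Suc i)" and "\<pi> \<in> permutations_of_set (pverts (G i))"
        then have \<pi>: "distinct \<pi>" by (auto dest: permutations_of_setD)
        interpret sparse_cubic_graph "G i" "\<kappa> * real (Suc i)" by (rule sparse)
        assume "real (card (pverts (G i))) / 240 < (\<Sum>v\<in>pverts (G i). local_excess v \<pi>)"
        from treewidth_ge[OF \<pi> this] have "\<kappa> * real (Suc i) \<le>
          1440 * (real (treewidth (layer_graph 3 (with_proj (G i)) \<pi>)) + 1) + 1"
          unfolding layer_graph_3 .
        moreover have "\<kappa> / 17280 * real (card (pverts (G i))) = \<kappa> * real (Suc i) / 2880"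
          unfolding card by simp
        ultimately show "real (treewidth (layer_graph 3 (with_proj (G i)) \<pi>)) \<ge>
            \<kappa> / 17280 * real (card (pverts (G i)))"
          using big by argo
      qed
    qed
  qed
qed

end
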